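(* Let $D$ be an integral domain with quotient field $K$ and let $E$ be a nonempty subset of $K$ which is a fractional subset of $D$. Then $D$ is a Jaffard domain if and only if $\mathrm{Int}^{\mathrm{R}}(E,D)$ is a Jaffard domain and $\dim(\mathrm{Int}^{\mathrm{R}}(E,D)) = 1+\dim(D)$.
   Context: For an integral domain $D$ with quotient field $K$ and $E\subseteq K$, the ring of integer-valued rational functions on $E$ over $D$ is $\mathrm{Int}^{\mathrm{R}}(E,D)=\{\varphi\in K(X) : \varphi(E)\subseteq D\}$ (in particular $\varphi$ is required to be defined at each point of $E$). A subset $E$ of $K$ is a fractional subset of $D$ if there is a nonzero $d\in D$ with $dE\subseteq D$. $\dim$ denotes Krull dimension. The valuative dimension $\dim_v(R)$ of an integral domain $R$ is the supremum of the Krull dimensions of the valuation overrings of $R$ (valuation rings between $R$ and its quotient field). One has $\dim(R)\leqslant \dim_v(R)$; $R$ is a Jaffard domain if $\dim(R)=\dim_v(R)<\infty$. *)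

theory Defs
  imports
    "HOL-Algebra.Algebraic_Closure_Type"
    "HOL-Computational_Algebra.Fraction_Field"
    "HOL-Library.Extended_Nat"
begin

text \<open>
  An integral domain is represented as a subring of a field, the latter being a type of class
  \<open>field\<close>; it need not generate that field. The domain \<open>D\<close> lives in \<open>'k\<close>, and rational functions
  over \<open>'k\<close> are elements of \<open>'k poly fract\<close>.
\<close>

definition subset_ring :: "'f::field set \<Rightarrow> 'f ring" where
  "subset_ring R = ring_of_type_algebra\<lparr>carrier := R\<rparr>"

definition is_subdomain :: "'f::field set \<Rightarrow> bool" where
  "is_subdomain R \<longleftrightarrow> subdomain R ring_of_type_algebra"

text \<open>The quotient field of \<open>R\<close>, formed inside the ambient field.\<close>

definition quot_field :: "'f::field set \<Rightarrow> 'f set" where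
  "quot_field R = {a / b |a b. a \<in> R \<and> b \<in> R \<and> b \<noteq> 0}"

definition fractional_subset :: "'f::field set \<Rightarrow> 'f set \<Rightarrow> bool" where
  "fractional_subset D E \<longleftrightarrow> E \<subseteq> quot_field D \<and> (\<exists>d\<in>D. d \<noteq> 0 \<and> (\<forall>x\<in>E. d * x \<in> D))"


subsection \<open>Krull dimension, valuative dimension, Jaffard domains\<close>

definition prime_chain :: "('a, 'b) ring_scheme \<Rightarrow> nat \<Rightarrow> (nat \<Rightarrow> 'a set) \<Rightarrow> bool" where
  "prime_chain R n P \<longleftrightarrow> (\<forall>i\<le>n. primeideal (P i) R) \<and> (\<forall>i<n. P i \<subset> P (Suc i))"

definition krull_dim :: "('a, 'b) ring_scheme \<Rightarrow> enat" where
  "krull_dim R = Sup {enat n |n. \<exists>P. prime_chain R n P}"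

definition valuation_ring :: "'f::field set \<Rightarrow> bool" where
  "valuation_ring V \<longleftrightarrow>
     is_subdomain V \<and> (\<forall>x\<in>quot_field V. x \<noteq> 0 \<longrightarrow> x \<in> V \<or> inverse x \<in> V)"

definition valuation_overring :: "'f::field set \<Rightarrow> 'f set \<Rightarrow> bool" where
  "valuation_overring R V \<longleftrightarrow> valuation_ring V \<and> R \<subseteq> V \<and> V \<subseteq> quot_field R"

definition valuative_dim :: "'f::field set \<Rightarrow> enat" where
  "valuative_dim R = Sup {krull_dim (subset_ring V) |V. valuation_overring R V}"

definition jaffard :: "'f::field set \<Rightarrow> bool" where
  "jaffard R \<longleftrightarrow> is_subdomain R \<and>
     krull_dim (subset_ring R) = valuative_dim R \<and> valuative_dim R < \<infinity>"


subsection \<open>Integer-valued rational functions\<close>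

definition rat_defined_at :: "'k::field poly fract \<Rightarrow> 'k \<Rightarrow> bool" where
  "rat_defined_at \<phi> a \<longleftrightarrow> (\<exists>p q. \<phi> = Fract p q \<and> poly q a \<noteq> 0)"

text \<open>Only meaningful where \<open>\<phi>\<close> is defined; see \<open>rat_eval_Fract\<close> for well-definedness.\<close>

definition rat_eval :: "'k::field poly fract \<Rightarrow> 'k \<Rightarrow> 'k" where
  "rat_eval \<phi> a = (THE v. \<exists>p q. \<phi> = Fract p q \<and> poly q a \<noteq> 0 \<and> v = poly p a / poly q a)"

definition IntR :: "'k::field set \<Rightarrow> 'k set \<Rightarrow> 'k poly fract set" where
  "IntR E D = {\<phi>. \<forall>a\<in>E. rat_defined_at \<phi> a \<and> rat_eval \<phi> a \<in> D}"

lemma rat_eval_Fract: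
  fixes p q :: "'k::field poly"
  assumes "poly q a \<noteq> 0"
  shows "rat_eval (Fract p q) a = poly p a / poly q a"
  unfolding rat_eval_def
proof (rule the_equality)
  show "\<exists>p' q'. Fract p q = Fract p' q' \<and> poly q' a \<noteq> 0 \<and>
          poly p a / poly q a = poly p' a / poly q' a"
    using assms by blast
next
  fix v
  assume "\<exists>p' q'. Fract p q = Fract p' q' \<and> poly q' a \<noteq> 0 \<and> v = poly p' a / poly q' a"
  then obtain p' q' where *: "Fract p q = Fract p' q'" "poly q' a \<noteq> 0"
    "v = poly p' a / poly q' a" by blast
  have "q \<noteq> 0" "q' \<noteq> 0" using assms * by auto
  with * have "p * q' = p' * q" by (simp add: eq_fract)
  hence "poly p a * poly q' a = poly p' a * poly q a" by (metis poly_mult)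
  thus "v = poly p a / poly q a" using assms *(2,3) by (simp add: frac_eq_eq)
qed

lemma is_subdomainI:
  fixes R :: "'f::field set"
  assumes "1 \<in> R" "\<And>x y. x \<in> R \<Longrightarrow> y \<in> R \<Longrightarrow> x - y \<in> R"
    "\<And>x y. x \<in> R \<Longrightarrow> y \<in> R \<Longrightarrow> x * y \<in> R"
  shows "is_subdomain R"
proof -
  interpret F: field "ring_of_type_algebra :: 'f ring" by (rule field_from_type_algebra)
  have z: "0 \<in> R" using assms(2)[OF assms(1) assms(1)] by simp
  have m: "- x \<in> R" if "x \<in> R" for x using assms(2)[OF z that] by simp
  have p: "x + y \<in> R" if "x \<in> R" "y \<in> R" for x y using assms(2)[OF that(1) m[OF that(2)]] by simp
  have inv: "\<ominus>\<^bsub>ring_of_type_algebra\<^esub> x = - x" for x :: 'f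
    by (rule F.minus_equality) (simp_all add: ring_of_type_algebra_def)
  have "subring R (ring_of_type_algebra :: 'f ring)"
    by (rule F.subringI) (use assms m p in \<open>auto simp: inv, auto simp: ring_of_type_algebra_def\<close>)
  then show ?thesis
    unfolding is_subdomain_def by (rule F.subdomainI')
qed

lemma is_subdomainD:
  fixes R :: "'f::field set"
  assumes "is_subdomain R"
  shows "1 \<in> R" "\<And>x y. x \<in> R \<Longrightarrow> y \<in> R \<Longrightarrow> x - y \<in> R"
    "\<And>x y. x \<in> R \<Longrightarrow> y \<in> R \<Longrightarrow> x * y \<in> R"
proof -
  interpret F: field "ring_of_type_algebra :: 'f ring" by (rule field_from_type_algebra)
  have inv: "\<ominus>\<^bsub>ring_of_type_algebra\<^esub> x = - x" for x :: 'f
    by (rule F.minus_equality) (simp_all add: ring_of_type_algebra_def)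
  have s: "subring R (ring_of_type_algebra :: 'f ring)"
    using assms unfolding is_subdomain_def subdomain_def subcring_def by blast
  show "1 \<in> R" using subringE(3)[OF s] by (simp add: ring_of_type_algebra_def)
  show "x * y \<in> R" if "x \<in> R" "y \<in> R" for x y
    using subringE(6)[OF s that] by (simp add: ring_of_type_algebra_def)
  show "x - y \<in> R" if "x \<in> R" "y \<in> R" for x y
    using subringE(7)[OF s that(1) subringE(5)[OF s that(2)]]
    by (simp add: inv) (simp add: ring_of_type_algebra_def)
qed

lemma is_subdomain_IntR:
  fixes D E :: "'k::field set"
  assumes "is_subdomain D"
  shows "is_subdomain (IntR E D)"
proof -
  note D = is_subdomainD[OF assms]
  have *: "\<phi> \<in> IntR E D \<longleftrightarrow>
      (\<forall>a\<in>E. \<exists>p q. \<phi> = Fract p q \<and> poly q a \<noteq> 0 \<and> poly p a / poly q a \<in> D)" for \<phi>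
    unfolding IntR_def rat_defined_at_def by (fastforce simp: rat_eval_Fract)
  show ?thesis
  proof (rule is_subdomainI)
    show "1 \<in> IntR E D"
      unfolding * using D(1) by (auto simp: One_fract_def intro!: exI[of _ 1])
  next
    fix x y assume xy: "x \<in> IntR E D" "y \<in> IntR E D"
    { fix a assume a: "a \<in> E"
      obtain p q where p: "x = Fract p q" "poly q a \<noteq> 0" "poly p a / poly q a \<in> D"
        using xy(1) a unfolding * by blast
      obtain r s where r: "y = Fract r s" "poly s a \<noteq> 0" "poly r a / poly s a \<in> D"
        using xy(2) a unfolding * by blast
      have nz: "q \<noteq> 0" "s \<noteq> 0" using p r by auto
      have "x - y = Fract (p * s - r * q) (q * s)" using p r nz by simp
      moreover have "poly (p * s - r * q) a / poly (q * s) a \<in> D"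
        using D(2)[OF p(3) r(3)] p r by (simp add: diff_frac_eq)
      ultimately have 1: "\<exists>p q. x - y = Fract p q \<and> poly q a \<noteq> 0 \<and> poly p a / poly q a \<in> D"
        using p r by (metis poly_mult mult_eq_0_iff)
      have "x * y = Fract (p * r) (q * s)" using p r by simp
      moreover have "poly (p * r) a / poly (q * s) a \<in> D"
        using D(3)[OF p(3) r(3)] by simp
      ultimately have "\<exists>p q. x * y = Fract p q \<and> poly q a \<noteq> 0 \<and> poly p a / poly q a \<in> D"
        using p r by (metis poly_mult mult_eq_0_iff)
      note 1 this }
    then show "x - y \<in> IntR E D" "x * y \<in> IntR E D" unfolding * by blast+
  qed
qed

end

theory Submission
  imports Defs "HOL-Computational_Algebra.Polynomial_Factorial"
begin

text \<open>
  Write \<open>R = Int\<^sup>R(E, D)\<close>. The equivalence follows from \<open>1 + dim D \<le> dim R \<le> dim\<^sub>v R\<close> and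
  \<open>dim\<^sub>v R = 1 + dim\<^sub>v D\<close>. Evaluation at a point \<open>a \<in> E\<close> maps \<open>R\<close> onto \<open>D\<close> with nonzero kernel,
  whence the first inequality; applied to a valuation overring \<open>V\<close> of \<open>D\<close> and the valuation ring
  \<open>Int\<^sup>R({a}, V) \<supseteq> R\<close> the same argument gives \<open>1 + dim\<^sub>v D \<le> dim\<^sub>v R\<close>. Conversely, a valuation overring
  \<open>W\<close> of \<open>R\<close> contracts to a valuation overring \<open>W \<inter> K\<close> of \<open>D\<close>, and in a chain of primes of \<open>W\<close> at most
  one inclusion becomes an equality in \<open>K\<close>, because two such collapses would produce two
  algebraically independent elements of \<open>K(X)\<close>.
\<close>

section \<open>Primes and dimensions of subrings of a field\<close>

text \<open>The bound \<open>dim R \<le> dim\<^sub>v R\<close> calls for one valuation ring that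
  sees a whole chain of primes \<open>P i\<close> of \<open>R\<close>. Instead of lifting the primes
  one by one, the proof picks \<open>x i\<close> in \<open>P (Suc i)\<close> outside
  \<open>P i\<close> and makes every \<open>x i / x (Suc i) ^ k\<close> a nonunit. These quotients
  lie in the maximal ideals of the localizations at the primes, and the sum of those maximal ideals
  is closed under products and omits 1. It lies in no evident local ring, which is why valuation
  rings are produced from algebras without unit. The fractional hypothesis acts through a single
  \<open>d\<close>: since \<open>dX\<close> is integer-valued, \<open>K(X)\<close> is the quotient
  field of \<open>R\<close>, and \<open>d(X - a)\<close> is the nonzero element killed by evaluation
  at \<open>a\<close>. Value groups are never formed; membership of a quotient in the valuation ring
  compares values.\<close>

lemma is_subdomain_closed:
  fixes R :: "'f::field set"
  assumes "is_subdomain R"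
  shows "0 \<in> R" "\<And>x. x \<in> R \<Longrightarrow> - x \<in> R" "\<And>x y. x \<in> R \<Longrightarrow> y \<in> R \<Longrightarrow> x + y \<in> R"
    "\<And>x n. x \<in> R \<Longrightarrow> x ^ n \<in> R"
proof -
  note R = is_subdomainD[OF assms]
  show 0: "0 \<in> R" using R(2)[OF R(1) R(1)] by simp
  show m: "- x \<in> R" if "x \<in> R" for x using R(2)[OF 0 that] by simp
  show "x + y \<in> R" if "x \<in> R" "y \<in> R" for x y using R(2)[OF that(1) m[OF that(2)]] by simp
  show "x ^ n \<in> R" if "x \<in> R" for x n using R(1,3) that by (induction n) auto
qed

lemma cring_subset_ring:
  fixes R :: "'f::field set"
  assumes "is_subdomain R"
  shows "cring (subset_ring R)"
proof -
  interpret F: cring "ring_of_type_algebra :: 'f ring" by (rule cring_from_type_algebra)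
  have "subcring R (ring_of_type_algebra :: 'f ring)"
    using assms unfolding is_subdomain_def subdomain_def by blast
  then show ?thesis
    unfolding subset_ring_def by (rule F.subcring_iff[THEN iffD1, rotated]) (simp add: ring_of_type_algebra_def)
qed

text \<open>Primality phrased with the operations of the ambient field, so that ideals of different
  subrings can be compared without ring records. \<open>primeideal_subset_ring_iff\<close>
  translates back.\<close>

definition prime_of :: "'f::field set \<Rightarrow> 'f set \<Rightarrow> bool" where
  "prime_of R P \<longleftrightarrow> P \<subseteq> R \<and> 0 \<in> P \<and> 1 \<notin> P \<and> (\<forall>x\<in>P. \<forall>y\<in>P. x + y \<in> P) \<and>
     (\<forall>a\<in>R. \<forall>x\<in>P. a * x \<in> P) \<and> (\<forall>a\<in>R. \<forall>b\<in>R. a * b \<in> P \<longrightarrow> a \<in> P \<or> b \<in> P)"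

lemma prime_ofD:
  assumes "prime_of R P"
  shows "P \<subseteq> R" "0 \<in> P" "1 \<notin> P" "\<And>x y. x \<in> P \<Longrightarrow> y \<in> P \<Longrightarrow> x + y \<in> P"
    "\<And>a x. a \<in> R \<Longrightarrow> x \<in> P \<Longrightarrow> a * x \<in> P"
    "\<And>a b. a \<in> R \<Longrightarrow> b \<in> R \<Longrightarrow> a * b \<in> P \<Longrightarrow> a \<in> P \<or> b \<in> P"
  using assms unfolding prime_of_def by blast+

lemma prime_of_uminus:
  fixes R :: "'f::field set"
  assumes "is_subdomain R" "prime_of R P" "x \<in> P"
  shows "- x \<in> P"
proof -
  have "(- 1) * x \<in> P"
    using prime_ofD(5)[OF assms(2)] is_subdomainD(1)[OF assms(1)]
      is_subdomain_closed(2)[OF assms(1)] assms(3) by blast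
  then show ?thesis by simp
qed

lemma prime_of_power:
  fixes R :: "'f::field set"
  assumes "is_subdomain R" "prime_of R P" "x \<in> R" "x ^ n \<in> P"
  shows "x \<in> P"
  using assms(4)
proof (induction n)
  case 0
  then show ?case using prime_ofD(3)[OF assms(2)] by simp
next
  case (Suc n)
  have "x \<in> P \<or> x ^ n \<in> P"
    using prime_ofD(6)[OF assms(2) assms(3) is_subdomain_closed(4)[OF assms(1,3)]] Suc.prems by simp
  then show ?case using Suc.IH by blast
qed

lemma primeideal_subset_ring_iff:
  fixes R :: "'f::field set"
  assumes "is_subdomain R"
  shows "primeideal P (subset_ring R) \<longleftrightarrow> prime_of R P"
proof
  let ?S = "subset_ring R"
  interpret cring ?S by (rule cring_subset_ring[OF assms])
  have sel: "carrier ?S = R" "\<And>x y. x \<otimes>\<^bsub>?S\<^esub> y = x * y" "\<And>x y. x \<oplus>\<^bsub>?S\<^esub> y = x + y"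
    "\<one>\<^bsub>?S\<^esub> = 1" "\<zero>\<^bsub>?S\<^esub> = 0"
    by (auto simp: subset_ring_def ring_of_type_algebra_def)
  {
    assume "primeideal P ?S"
    then interpret I: primeideal P ?S .
    have "1 \<notin> P" using I.one_imp_carrier I.I_notcarr sel by auto
    then show "prime_of R P"
      unfolding prime_of_def
      using I.Icarr I.a_closed I.zero_closed I.I_l_closed I.I_prime by (auto simp: sel)
  next
    assume P: "prime_of R P"
    note D = prime_ofD[OF P]
    have inv: "\<ominus>\<^bsub>?S\<^esub> x = - x" if "x \<in> R" for x
      by (rule minus_equality) (use that is_subdomain_closed(2)[OF assms] in \<open>auto simp: sel\<close>)
    have sg: "subgroup P (add_monoid ?S)"
    proof (rule add.subgroupI)
      show "P \<subseteq> carrier ?S" using D(1) by (simp add: sel)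
      show "P \<noteq> {}" using D(2) by blast
      show "\<ominus>\<^bsub>?S\<^esub> x \<in> P" if "x \<in> P" for x
        using inv[of x] D(1) that prime_of_uminus[OF assms P] by auto
      show "x \<oplus>\<^bsub>?S\<^esub> y \<in> P" if "x \<in> P" "y \<in> P" for x y
        using that D(4) by (simp add: sel)
    qed
    show "primeideal P ?S"
    proof (rule primeidealI)
      show "ideal P ?S"
      proof (rule idealI[OF ring_axioms sg])
        show "a \<otimes>\<^bsub>?S\<^esub> x \<in> P" "x \<otimes>\<^bsub>?S\<^esub> a \<in> P" if "x \<in> P" "a \<in> carrier ?S" for x a
          using D(5)[of a x] that by (simp_all add: sel mult.commute[of x a])
      qed
      show "carrier ?S \<noteq> P" using D(3) is_subdomainD(1)[OF assms] by (auto simp: sel)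
    qed (use D(6) is_cring in \<open>auto simp: sel\<close>)
  }
qed

lemma prime_chain_subset_ring_iff:
  fixes R :: "'f::field set"
  assumes "is_subdomain R"
  shows "prime_chain (subset_ring R) n P \<longleftrightarrow>
    (\<forall>i\<le>n. prime_of R (P i)) \<and> (\<forall>i<n. P i \<subset> P (Suc i))"
  unfolding prime_chain_def primeideal_subset_ring_iff[OF assms] ..

lemma prime_of_zero:
  fixes R :: "'f::field set"
  assumes "is_subdomain R"
  shows "prime_of R {0}"
  using is_subdomain_closed(1)[OF assms] unfolding prime_of_def by auto

lemma krull_dim_geI: "prime_chain R n P \<Longrightarrow> enat n \<le> krull_dim R"
  unfolding krull_dim_def by (rule Sup_upper) blast

lemma krull_dim_leI: "(\<And>n P. prime_chain R n P \<Longrightarrow> enat n \<le> c) \<Longrightarrow> krull_dim R \<le> c"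
  unfolding krull_dim_def by (rule Sup_least) blast

text \<open>\<open>eSuc\<close> commutes with suprema of nonempty sets only, because
  \<open>Sup {} = 0\<close>. The chain consisting of the zero ideal supplies nonemptiness.\<close>

lemma eSuc_krull_dim_leI:
  fixes R :: "'f::field set"
  assumes "is_subdomain R"
    and "\<And>n P. prime_chain (subset_ring R) n P \<Longrightarrow> eSuc (enat n) \<le> c"
  shows "eSuc (krull_dim (subset_ring R)) \<le> c"
proof -
  have "prime_chain (subset_ring R) 0 (\<lambda>_. {0})"
    using prime_of_zero[OF assms(1)] by (simp add: prime_chain_subset_ring_iff[OF assms(1)])
  then have ne: "{enat n |n. \<exists>P. prime_chain (subset_ring R) n P} \<noteq> {}" by blast
  show ?thesis
    unfolding krull_dim_def eSuc_Sup[OF ne] by (rule Sup_least) (use assms(2) in auto)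
qed

section \<open>Valuation rings whose quotient field is the whole ambient field\<close>

lemma valuation_ringI:
  assumes "is_subdomain V" "\<And>x. x \<noteq> 0 \<Longrightarrow> x \<in> V \<or> inverse x \<in> V"
  shows "valuation_ring V"
  using assms unfolding valuation_ring_def by blast

lemma quot_field_mono: "R \<subseteq> S \<Longrightarrow> quot_field R \<subseteq> quot_field S"
  unfolding quot_field_def by blast

text \<open>An overring of \<open>R\<close> also has the whole ambient field as quotient field, so
  the alternative between \<open>x\<close> and its inverse holds for every nonzero \<open>x\<close>.
  Later lemmas take valuation rings in this explicit form.\<close>

lemma valuation_overringD:
  assumes "valuation_overring R V" "quot_field R = UNIV"
  shows "is_subdomain V" "R \<subseteq> V" "\<And>x. x \<noteq> 0 \<Longrightarrow> x \<in> V \<or> inverse x \<in> V"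
  using assms quot_field_mono[of R V] unfolding valuation_overring_def valuation_ring_def by auto

lemma valuation_overringI:
  assumes "quot_field R = UNIV" "R \<subseteq> V" "is_subdomain V"
    "\<And>x. x \<noteq> 0 \<Longrightarrow> x \<in> V \<or> inverse x \<in> V"
  shows "valuation_overring R V"
  using assms valuation_ringI[of V] unfolding valuation_overring_def by auto

section \<open>Existence of valuation rings\<close>

text \<open>A set \<open>N\<close> as below that is maximal subject to \<open>1 \<notin> N\<close> is the maximal ideal of the valuation
  ring \<open>{v. v N \<subseteq> N}\<close>; this is the point of considering rings without unit.\<close>

definition proper_nonunital_algebra :: "'f::field set \<Rightarrow> 'f set \<Rightarrow> bool" where
  "proper_nonunital_algebra R N \<longleftrightarrow> 0 \<in> N \<and> 1 \<notin> N \<and> (\<forall>x\<in>N. \<forall>y\<in>N. x + y \<in> N \<and> x * y \<in> N) \<and>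
     (\<forall>a\<in>R. \<forall>x\<in>N. a * x \<in> N)"

lemma maximal_proper_nonunital_algebra:
  assumes "proper_nonunital_algebra R I"
  obtains N where "I \<subseteq> N" "proper_nonunital_algebra R N"
    "\<And>M. N \<subseteq> M \<Longrightarrow> proper_nonunital_algebra R M \<Longrightarrow> M = N"
proof -
  let ?A = "{N. I \<subseteq> N \<and> proper_nonunital_algebra R N}"
  have "\<exists>M\<in>?A. \<forall>Y\<in>?A. M \<subseteq> Y \<longrightarrow> Y = M"
  proof (rule subset_Zorn_nonempty)
    show "?A \<noteq> {}" using assms by blast
    fix C assume ne: "C \<noteq> {}" and C: "subset.chain ?A C"
    have sub: "C \<subseteq> ?A" and tot: "\<And>Y Z. Y \<in> C \<Longrightarrow> Z \<in> C \<Longrightarrow> Y \<subseteq> Z \<or> Z \<subseteq> Y"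
      using C unfolding subset_chain_def by blast+
    have common: "\<exists>Y\<in>C. x \<in> Y \<and> y \<in> Y" if "x \<in> \<Union>C" "y \<in> \<Union>C" for x y
      using that tot by (meson UnionE subsetD)
    have "x + y \<in> \<Union>C" "x * y \<in> \<Union>C" if "x \<in> \<Union>C" "y \<in> \<Union>C" for x y
      using common[OF that] sub unfolding proper_nonunital_algebra_def by blast+
    moreover have "a * x \<in> \<Union>C" if "a \<in> R" "x \<in> \<Union>C" for a x
      using that sub unfolding proper_nonunital_algebra_def by blast
    moreover have "0 \<in> \<Union>C" "1 \<notin> \<Union>C" "I \<subseteq> \<Union>C"
      using ne sub unfolding proper_nonunital_algebra_def by blast+
    ultimately show "\<Union>C \<in> ?A" unfolding proper_nonunital_algebra_def by blast
  qed
  then show ?thesis using that by auto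
qed

text \<open>A Chevalley-type extension argument. If neither \<open>x\<close> nor
  \<open>inverse x\<close> preserved the maximal \<open>N\<close>, adjoining either one would
  produce 1, and the two resulting relations can be shortened against each other until nothing is
  left. The last clause says that nonzero elements of \<open>I\<close> are nonunits of
  \<open>V\<close>.\<close>

lemma exists_valuation_ring:
  fixes R I :: "'f::field set"
  assumes R: "is_subdomain R" and I: "proper_nonunital_algebra R I"
  obtains V where "is_subdomain V" "R \<subseteq> V" "\<And>x. x \<noteq> 0 \<Longrightarrow> x \<in> V \<or> inverse x \<in> V"
    "I \<subseteq> V" "\<And>x. x \<in> I \<Longrightarrow> inverse x \<in> V \<Longrightarrow> x = 0"
proof -
  obtain N where N: "I \<subseteq> N" "proper_nonunital_algebra R N"
    and max: "\<And>M. N \<subseteq> M \<Longrightarrow> proper_nonunital_algebra R M \<Longrightarrow> M = N"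
    using maximal_proper_nonunital_algebra[OF I] by blast
  have N0: "0 \<in> N" and N1: "1 \<notin> N" and Nadd: "\<And>x y. x \<in> N \<Longrightarrow> y \<in> N \<Longrightarrow> x + y \<in> N"
    and Nmult: "\<And>x y. x \<in> N \<Longrightarrow> y \<in> N \<Longrightarrow> x * y \<in> N"
    and NR: "\<And>a x. a \<in> R \<Longrightarrow> x \<in> N \<Longrightarrow> a * x \<in> N"
    using N(2) unfolding proper_nonunital_algebra_def by blast+
  have Nneg: "- x \<in> N" if "x \<in> N" for x
    using NR[OF is_subdomain_closed(2)[OF R is_subdomainD(1)[OF R]] that] by simp
  have Nsum: "(\<Sum>i\<in>A. f i) \<in> N" if "\<And>i. i \<in> A \<Longrightarrow> f i \<in> N" for A and f :: "nat \<Rightarrow> 'f"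
    using that by (induction A rule: infinite_finite_induct) (auto intro: N0 Nadd)
  define V where "V = {v. \<forall>x\<in>N. v * x \<in> N}"
  have VN: "v * x \<in> N" if "v \<in> V" "x \<in> N" for v x using that unfolding V_def by blast
  have V: "is_subdomain V"
  proof (rule is_subdomainI)
    show "1 \<in> V" by (simp add: V_def)
    show "x - y \<in> V" if "x \<in> V" "y \<in> V" for x y
    proof -
      have "(x - y) * z \<in> N" if "z \<in> N" for z
        using Nadd[OF VN[OF \<open>x \<in> V\<close> that] Nneg[OF VN[OF \<open>y \<in> V\<close> that]]]
        by (simp add: algebra_simps)
      then show ?thesis by (simp add: V_def)
    qed
    show "x * y \<in> V" if "x \<in> V" "y \<in> V" for x y
      using that unfolding V_def by (simp add: mult.assoc)
  qed
  \<comment> \<open>The elements that some power of \<open>1 - m\<close> carries into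
    \<open>N\<close> form an algebra containing \<open>N\<close>. It is proper because those powers
    are again of the form \<open>1 - m'\<close>, so maximality makes it equal to
    \<open>N\<close>.\<close>
  have unit: "inverse (1 - m) \<in> V" if m: "m \<in> N" for m
  proof -
    have m1: "1 - m \<noteq> 0" using N1 m by auto
    have pw: "\<exists>m'\<in>N. (1 - m) ^ j = 1 - m'" for j
    proof (induction j)
      case (Suc j)
      then obtain m' where m': "m' \<in> N" "(1 - m) ^ j = 1 - m'" by blast
      have "m + m' + - (m * m') \<in> N" by (intro Nadd Nneg Nmult m m'(1))
      moreover have "(1 - m) ^ Suc j = 1 - (m + m' + - (m * m'))"
        unfolding power_Suc m'(2) by (simp add: algebra_simps)
      ultimately show ?case by blast
    qed (use N0 in \<open>auto intro!: bexI[of _ 0]\<close>)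
    have up: "(1 - m) ^ j * x \<in> N" if "x \<in> N" for j x
    proof -
      obtain m' where m': "m' \<in> N" "(1 - m) ^ j = 1 - m'" using pw by blast
      have "x + - (m' * x) \<in> N" by (intro Nadd Nneg Nmult that m'(1))
      then show ?thesis unfolding m'(2) by (simp add: algebra_simps)
    qed
    define M where "M = {y. \<exists>j. (1 - m) ^ j * y \<in> N}"
    have "M = N"
    proof (rule max)
      show "N \<subseteq> M" unfolding M_def by (auto intro: exI[of _ 0])
      have "1 \<notin> M"
      proof
        assume "1 \<in> M"
        then obtain j where j: "(1 - m) ^ j \<in> N" unfolding M_def by auto
        obtain m' where m': "m' \<in> N" "(1 - m) ^ j = 1 - m'" using pw by blast
        have "1 = (1 - m) ^ j + m'" using m' by simp
        then show False using Nadd[OF j m'(1)] N1 by simp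
      qed
      moreover have "x + y \<in> M \<and> x * y \<in> M" if "x \<in> M" "y \<in> M" for x y
      proof -
        obtain i j where i: "(1 - m) ^ i * x \<in> N" and j: "(1 - m) ^ j * y \<in> N"
          using \<open>x \<in> M\<close> \<open>y \<in> M\<close> unfolding M_def by blast
        have "(1 - m) ^ j * ((1 - m) ^ i * x) + (1 - m) ^ i * ((1 - m) ^ j * y) \<in> N"
          by (intro Nadd up i j)
        then have "(1 - m) ^ (i + j) * (x + y) \<in> N" by (simp add: algebra_simps power_add)
        moreover have "(1 - m) ^ (i + j) * (x * y) \<in> N"
          using Nmult[OF i j] by (simp add: algebra_simps power_add)
        ultimately show ?thesis unfolding M_def by blast
      qed
      moreover have "a * x \<in> M" if a: "a \<in> R" and x: "x \<in> M" for a x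
      proof -
        obtain i where "(1 - m) ^ i * x \<in> N" using x unfolding M_def by blast
        then have "(1 - m) ^ i * (a * x) \<in> N" using NR[OF a] by (metis mult.left_commute)
        then show ?thesis unfolding M_def by blast
      qed
      moreover have "0 \<in> M" using N0 unfolding M_def by auto
      ultimately show "proper_nonunital_algebra R M"
        unfolding proper_nonunital_algebra_def by blast
    qed
    moreover have "inverse (1 - m) * x \<in> M" if "x \<in> N" for x
      using m1 that unfolding M_def by (auto intro!: exI[of _ 1] simp: mult.assoc[symmetric])
    ultimately show ?thesis unfolding V_def by blast
  qed
  \<comment> \<open>The values at \<open>x\<close> of polynomials with coefficients in
    \<open>N\<close> form an algebra containing \<open>N\<close> and all products of
    \<open>x\<close> with elements of \<open>N\<close>. Were 1 not among them, maximality would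
    force \<open>x\<close> into \<open>V\<close>.\<close>
  have poly1: "\<exists>m n. (\<forall>i. m i \<in> N) \<and> 1 = (\<Sum>i\<le>n. m i * x ^ i)" if x: "x \<notin> V" for x
  proof (rule ccontr)
    assume none: "\<not> ?thesis"
    define M where "M = {poly p x |p. \<forall>i. coeff p i \<in> N}"
    have "1 \<notin> M"
      using none unfolding M_def by (auto simp: poly_altdef)
    moreover have "y + z \<in> M \<and> y * z \<in> M" if "y \<in> M" "z \<in> M" for y z
    proof -
      obtain p q where p: "y = poly p x" "\<forall>i. coeff p i \<in> N" and q: "z = poly q x" "\<forall>i. coeff q i \<in> N"
        using \<open>y \<in> M\<close> \<open>z \<in> M\<close> unfolding M_def by blast
      have "y + z = poly (p + q) x" "\<forall>i. coeff (p + q) i \<in> N" using p q Nadd by auto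
      moreover have "y * z = poly (p * q) x" "\<forall>i. coeff (p * q) i \<in> N"
        using p q by (auto simp: coeff_mult intro!: Nsum Nmult)
      ultimately show ?thesis unfolding M_def by blast
    qed
    moreover have "a * y \<in> M" if a: "a \<in> R" and y: "y \<in> M" for a y
    proof -
      obtain p where p: "y = poly p x" "\<forall>i. coeff p i \<in> N" using y unfolding M_def by blast
      have "a * y = poly (Polynomial.smult a p) x" "\<forall>i. coeff (Polynomial.smult a p) i \<in> N"
        using p NR[OF a] by auto
      then show ?thesis unfolding M_def by blast
    qed
    moreover have "0 \<in> M" unfolding M_def using N0 by (auto intro!: exI[of _ 0])
    ultimately have "proper_nonunital_algebra R M"
      unfolding proper_nonunital_algebra_def by blast
    moreover have "N \<subseteq> M"
    proof
      fix y assume "y \<in> N"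
      then have "y = poly [:y:] x" "\<forall>i. coeff [:y:] i \<in> N"
        using N0 by (auto simp: coeff_pCons split: nat.split)
      then show "y \<in> M" unfolding M_def by blast
    qed
    ultimately have "M = N" using max by blast
    moreover have "x * y \<in> M" if y: "y \<in> N" for y
    proof -
      have "x * y = poly [:0, y:] x" "\<forall>i. coeff [:0, y:] i \<in> N"
        using N0 y by (auto simp: coeff_pCons split: nat.split)
      then show ?thesis unfolding M_def by blast
    qed
    ultimately show False using x unfolding V_def by blast
  qed
  \<comment> \<open>Dividing the relation for \<open>inverse x\<close> by the unit
    \<open>1 - m' 0\<close> and multiplying by \<open>x ^ Suc n\<close> expresses this top power by
    lower ones; \<open>k \<le> Suc n\<close> keeps the exponents nonnegative. Substitution removes
    it from the relation for \<open>x\<close>.\<close>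
  have reduce: "\<exists>m''. (\<forall>i. m'' i \<in> N) \<and> 1 = (\<Sum>i\<le>n. m'' i * x ^ i)"
    if x: "x \<noteq> 0" and m: "\<forall>i. m i \<in> N" "1 = (\<Sum>i\<le>Suc n. m i * x ^ i)"
      and m': "\<forall>i. m' i \<in> N" "1 = (\<Sum>i\<le>k. m' i * inverse x ^ i)" and k: "k \<le> Suc n"
    for x m m' n k
  proof -
    define u where "u = inverse (1 - m' 0)"
    have uV: "u \<in> V" unfolding u_def using unit m'(1) by blast
    have u0: "1 - m' 0 \<noteq> 0" using N1 m'(1) by (metis eq_iff_diff_eq_0)
    have k0: "k \<noteq> 0"
    proof
      assume "k = 0" then have "1 = m' 0" using m'(2) by simp
      then show False using u0 by simp
    qed
    have "(\<Sum>i\<le>k. m' i * inverse x ^ i) = m' 0 + (\<Sum>i=1..k. m' i * inverse x ^ i)"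
      by (simp add: sum.atLeast_Suc_atMost[of 0 k, simplified] atMost_atLeast0)
    then have "1 - m' 0 = (\<Sum>i=1..k. m' i * inverse x ^ i)" using m'(2) by (simp add: algebra_simps)
    then have "1 = u * (\<Sum>i=1..k. m' i * inverse x ^ i)" unfolding u_def using u0 by simp
    then have "x ^ Suc n = u * (\<Sum>i=1..k. m' i * inverse x ^ i) * x ^ Suc n" by simp
    also have "\<dots> = (\<Sum>i=1..k. u * m' i * x ^ (Suc n - i))"
      unfolding sum_distrib_left sum_distrib_right
    proof (rule sum.cong)
      fix i assume i: "i \<in> {1..k}"
      then have "x ^ Suc n = x ^ (Suc n - i) * x ^ i" using k by (simp flip: power_add)
      then show "u * (m' i * inverse x ^ i) * x ^ Suc n = u * m' i * x ^ (Suc n - i)"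
        using x by (simp add: field_simps del: power_Suc)
    qed simp
    also have "\<dots> = (\<Sum>j\<in>{Suc n - k..n}. u * m' (Suc n - j) * x ^ j)"
      by (rule sum.reindex_bij_witness[of _ "\<lambda>j. Suc n - j" "\<lambda>i. Suc n - i"]) (use k k0 in auto)
    also have "\<dots> = (\<Sum>j\<le>n. (if Suc n - k \<le> j then u * m' (Suc n - j) * x ^ j else 0))"
      by (simp add: sum.If_cases Int_def) (rule sum.cong; auto)
    finally have xn: "x ^ Suc n = (\<Sum>j\<le>n. (if Suc n - k \<le> j then u * m' (Suc n - j) * x ^ j else 0))" .
    let ?m = "\<lambda>j. m j + (if Suc n - k \<le> j then m (Suc n) * (u * m' (Suc n - j)) else 0)"
    have "1 = (\<Sum>i\<le>n. m i * x ^ i) + m (Suc n) * x ^ Suc n" using m(2) by simp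
    also have "\<dots> = (\<Sum>j\<le>n. ?m j * x ^ j)"
      unfolding xn sum_distrib_left sum.distrib[symmetric]
      by (rule sum.cong) (auto simp: algebra_simps)
    finally have "1 = (\<Sum>j\<le>n. ?m j * x ^ j)" .
    moreover have "\<forall>j. ?m j \<in> N"
      using m(1) m'(1) Nmult VN[OF uV] N0 by (auto intro!: Nadd)
    ultimately show ?thesis by (intro exI[of _ ?m]) blast
  qed
  have contra: False
    if "x \<noteq> 0" "\<forall>i. m i \<in> N" "1 = (\<Sum>i\<le>n. m i * x ^ i)"
      "\<forall>i. m' i \<in> N" "1 = (\<Sum>i\<le>k. m' i * inverse x ^ i)" for x m n m' k
    using that
  \<comment> \<open>The longer relation is shortened each time. \<open>x\<close> is arbitrary
    because \<open>x\<close> and \<open>inverse x\<close> exchange roles when \<open>n < k\<close>;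
    at length zero the relation says that 1 lies in \<open>N\<close>.\<close>
  proof (induction "n + k" arbitrary: x m n m' k rule: less_induct)
    case less
    show ?case
    proof (cases "k \<le> n")
      case True
      show False
      proof (cases n)
        case 0
        then show False using less.prems(2,3) N1 by simp (metis)
      next
        case (Suc l)
        obtain m'' where "\<forall>i. m'' i \<in> N" "1 = (\<Sum>i\<le>l. m'' i * x ^ i)"
          using reduce[OF less.prems(1,2) _ less.prems(4,5), of l] less.prems(3) True Suc by blast
        then show False using less.hyps[OF _ less.prems(1) _ _ less.prems(4,5), of l] Suc by auto
      qed
    next
      case False
      then obtain l where l: "k = Suc l" "n \<le> l" by (metis not_less Suc_le_D le_SucE nat_le_linear less_Suc_eq_le not_less_eq_eq)
      have ix: "inverse x \<noteq> 0" "inverse (inverse x) = x" using less.prems(1) by auto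
      obtain m'' where "\<forall>i. m'' i \<in> N" "1 = (\<Sum>i\<le>l. m'' i * inverse x ^ i)"
        using reduce[of "inverse x" m' l m n] less.prems ix l by auto
      then show False using less.hyps[OF _ less.prems(1,2,3), of l m''] l by auto
    qed
  qed
  show ?thesis
  proof
    show "is_subdomain V" by (rule V)
    show "R \<subseteq> V" unfolding V_def using NR by blast
    show "x \<in> V \<or> inverse x \<in> V" if "x \<noteq> 0" for x
      using poly1[of x] poly1[of "inverse x"] contra[OF that] by blast
    show "I \<subseteq> V" unfolding V_def using N(1) Nmult by blast
    show "x = 0" if "x \<in> I" "inverse x \<in> V" for x
      using VN[OF that(2)] N(1) that(1) N1 by (metis left_inverse subsetD)
  qed
qed

section \<open>Krull dimension is at most valuative dimension\<close>

definition local_ring :: "'f::field set \<Rightarrow> 'f set \<Rightarrow> 'f set" where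
  "local_ring R P = {a / t |a t. a \<in> R \<and> t \<in> R - P}"

definition local_ideal :: "'f::field set \<Rightarrow> 'f set \<Rightarrow> 'f set" where
  "local_ideal R P = {a / t |a t. a \<in> P \<and> t \<in> R - P}"

primrec local_ideal_sum :: "'f::field set \<Rightarrow> (nat \<Rightarrow> 'f set) \<Rightarrow> nat \<Rightarrow> 'f set" where
  "local_ideal_sum R P 0 = local_ideal R (P 0)"
| "local_ideal_sum R P (Suc k) =
    {x + y |x y. x \<in> local_ideal_sum R P k \<and> y \<in> local_ideal R (P (Suc k))}"

lemma local_ideal_closed:
  fixes R :: "'f::field set"
  assumes R: "is_subdomain R" and P: "prime_of R P"
  shows "0 \<in> local_ideal R P"
    "\<And>x y. x \<in> local_ideal R P \<Longrightarrow> y \<in> local_ideal R P \<Longrightarrow> x + y \<in> local_ideal R P"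
    "\<And>x y. x \<in> local_ring R P \<Longrightarrow> y \<in> local_ideal R P \<Longrightarrow> x * y \<in> local_ideal R P"
    "P \<subseteq> local_ideal R P" "local_ideal R P \<subseteq> local_ring R P" "R \<subseteq> local_ring R P"
proof -
  note D = prime_ofD[OF P]
  have one: "1 \<in> R - P" using D(3) is_subdomainD(1)[OF R] by blast
  have mult: "s * t \<in> R - P" if "s \<in> R - P" "t \<in> R - P" for s t
    using that D(6) is_subdomainD(3)[OF R] by blast
  have nz: "t \<noteq> 0" if "t \<in> R - P" for t using that D(2) by blast
  show "0 \<in> local_ideal R P" unfolding local_ideal_def using one D(2) by fastforce
  show "local_ideal R P \<subseteq> local_ring R P"
    unfolding local_ideal_def local_ring_def using D(1) by blast
  have "\<exists>a t. x = a / t \<and> a \<in> A \<and> t \<in> R - P" if "x \<in> A" for x A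
    using one that by (intro exI[of _ x] exI[of _ 1]) simp
  then show "P \<subseteq> local_ideal R P" "R \<subseteq> local_ring R P"
    unfolding local_ideal_def local_ring_def by (auto simp del: Diff_iff)
  show "x + y \<in> local_ideal R P" if xy: "x \<in> local_ideal R P" "y \<in> local_ideal R P" for x y
  proof -
    obtain a s b t where *: "x = a / s" "y = b / t" "a \<in> P" "b \<in> P" "s \<in> R - P" "t \<in> R - P"
      using xy unfolding local_ideal_def by blast
    have "x + y = (t * a + s * b) / (s * t)" using * nz by (simp add: field_simps)
    moreover have "t * a + s * b \<in> P" using * D(4,5) by blast
    ultimately show ?thesis using mult * unfolding local_ideal_def by blast
  qed
  show "x * y \<in> local_ideal R P" if xy: "x \<in> local_ring R P" "y \<in> local_ideal R P" for x y
  proof -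
    obtain a s b t where *: "x = a / s" "y = b / t" "a \<in> R" "b \<in> P" "s \<in> R - P" "t \<in> R - P"
      using xy unfolding local_ideal_def local_ring_def by blast
    have "x * y = (a * b) / (s * t)" using * by simp
    then show ?thesis using mult * D(5) unfolding local_ideal_def by blast
  qed
qed

lemma local_ring_antimono: "P \<subseteq> Q \<Longrightarrow> local_ring R Q \<subseteq> local_ring R P"
  unfolding local_ring_def by blast

lemma chain_mono:
  fixes P :: "nat \<Rightarrow> 'a set"
  assumes "\<forall>i<n. P i \<subset> P (Suc i)" "i \<le> j" "j \<le> n"
  shows "P i \<subseteq> P j"
  using assms(2,3)
proof (induction j rule: dec_induct)
  case (step m)
  then have "P i \<subseteq> P m" "P m \<subset> P (Suc m)" using assms(1) by simp_all
  then show ?case by blast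
qed simp

context
  fixes R :: "'f::field set" and P :: "nat \<Rightarrow> 'f set" and n :: nat
  assumes R: "is_subdomain R" and P: "\<forall>i\<le>n. prime_of R (P i)" "\<forall>i<n. P i \<subset> P (Suc i)"
begin

lemma local_ideal_sum_add:
  "k \<le> n \<Longrightarrow> x \<in> local_ideal_sum R P k \<Longrightarrow> y \<in> local_ideal_sum R P k \<Longrightarrow>
    x + y \<in> local_ideal_sum R P k"
proof (induction k arbitrary: x y)
  case 0
  then show ?case using local_ideal_closed(2)[OF R] P(1) by simp
next
  case (Suc k)
  obtain a b c d where *: "x = a + b" "y = c + d" "a \<in> local_ideal_sum R P k"
    "c \<in> local_ideal_sum R P k" "b \<in> local_ideal R (P (Suc k))" "d \<in> local_ideal R (P (Suc k))"
    using Suc.prems by auto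
  have "x + y = (a + c) + (b + d)" using * by simp
  moreover have "a + c \<in> local_ideal_sum R P k" using Suc * by simp
  moreover have "b + d \<in> local_ideal R (P (Suc k))"
    using * local_ideal_closed(2)[OF R] P(1) Suc.prems(1) by blast
  ultimately show ?case by auto
qed

lemma local_ideal_sum_smult:
  "k \<le> n \<Longrightarrow> x \<in> local_ring R (P k) \<Longrightarrow> y \<in> local_ideal_sum R P k \<Longrightarrow>
    x * y \<in> local_ideal_sum R P k"
proof (induction k arbitrary: x y)
  case 0
  then show ?case using local_ideal_closed(3)[OF R] P(1) by simp
next
  case (Suc k)
  obtain a b where *: "y = a + b" "a \<in> local_ideal_sum R P k" "b \<in> local_ideal R (P (Suc k))"
    using Suc.prems by auto
  have "x \<in> local_ring R (P k)"
    using Suc.prems P(2) local_ring_antimono[of "P k" "P (Suc k)" R] by (auto simp: Suc_le_eq)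
  then have "x * a \<in> local_ideal_sum R P k" using Suc * by simp
  moreover have "x * b \<in> local_ideal R (P (Suc k))"
    using * local_ideal_closed(3)[OF R] P(1) Suc.prems by blast
  moreover have "x * y = x * a + x * b" using * by (simp add: algebra_simps)
  ultimately show ?case by auto
qed

lemma zero_in_local_ideal_sum: "k \<le> n \<Longrightarrow> 0 \<in> local_ideal_sum R P k"
proof (induction k)
  case 0
  then show ?case using local_ideal_closed(1)[OF R] P(1) by simp
next
  case (Suc k)
  have "0 \<in> local_ideal R (P (Suc k))" using local_ideal_closed(1)[OF R] P(1) Suc.prems by blast
  then show ?case using Suc by (auto intro!: exI[of _ 0])
qed

lemma local_ideal_subset_sum: "k \<le> n \<Longrightarrow> i \<le> k \<Longrightarrow> local_ideal R (P i) \<subseteq> local_ideal_sum R P k"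
proof (induction k)
  case (Suc k)
  show ?case
  proof (cases "i = Suc k")
    case True
    show ?thesis using True zero_in_local_ideal_sum[of k] Suc.prems by (force intro: exI[of _ 0])
  next
    case False
    then have "local_ideal R (P i) \<subseteq> local_ideal_sum R P k" using Suc by simp
    moreover have "0 \<in> local_ideal R (P (Suc k))" using local_ideal_closed(1)[OF R] P(1) Suc.prems by blast
    ultimately show ?thesis by (force intro: exI[of _ 0])
  qed
qed simp

text \<open>Localizations shrink as the primes grow. Hence a product of elements from the summands
  at \<open>P i\<close> and \<open>P j\<close> with \<open>i \<le> j\<close> stays in the summand at
  \<open>P i\<close>, which is an ideal of the larger local ring.\<close>

lemma local_ideal_sum_mult:
  "k \<le> n \<Longrightarrow> x \<in> local_ideal_sum R P k \<Longrightarrow> y \<in> local_ideal_sum R P k \<Longrightarrow>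
    x * y \<in> local_ideal_sum R P k"
proof (induction k arbitrary: x y)
  case 0
  then show ?case using local_ideal_closed(3,5)[OF R] P(1) by fastforce
next
  case (Suc k)
  obtain a b c d where *: "x = a + b" "y = c + d" "a \<in> local_ideal_sum R P k"
    "c \<in> local_ideal_sum R P k" "b \<in> local_ideal R (P (Suc k))" "d \<in> local_ideal R (P (Suc k))"
    using Suc.prems by auto
  have L: "local_ideal R (P (Suc k)) \<subseteq> local_ring R (P (Suc k))"
    using local_ideal_closed(5)[OF R] P(1) Suc.prems by blast
  have "P k \<subseteq> P (Suc k)" using P(2) Suc.prems(1) by (simp add: Suc_le_eq psubset_imp_subset)
  from local_ring_antimono[OF this] L
  have r: "b \<in> local_ring R (P k)" "d \<in> local_ring R (P k)" using * by blast+
  have "a * c + (d * a + b * c) \<in> local_ideal_sum R P k"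
    using Suc.IH Suc.prems(1) * local_ideal_sum_smult[of k] local_ideal_sum_add[of k] r by simp
  moreover have "b * d \<in> local_ideal R (P (Suc k))"
    using * local_ideal_closed(3)[OF R] P(1) Suc.prems(1) L by blast
  moreover have "x * y = (a * c + (d * a + b * c)) + b * d" using * by (simp add: algebra_simps)
  ultimately show ?case by auto
qed

text \<open>Clearing the last denominator \<open>t\<close> leaves an element of \<open>R\<close> in
  the shorter sum, hence in \<open>P k\<close> by induction and so in \<open>P (Suc k)\<close>. As
  \<open>t\<close> is outside \<open>P (Suc k)\<close>, it can be cancelled. With
  \<open>s = 1\<close> this shows that the sum is proper.\<close>

lemma local_ideal_sum_inter: "k \<le> n \<Longrightarrow> s \<in> R \<Longrightarrow> s \<in> local_ideal_sum R P k \<Longrightarrow> s \<in> P k"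
proof (induction k arbitrary: s)
  case 0
  then obtain a t where *: "s = a / t" "a \<in> P 0" "t \<in> R - P 0" by (auto simp: local_ideal_def)
  have p: "prime_of R (P 0)" using P by simp
  then have "s * t \<in> P 0" using * prime_ofD(2)[OF p] by (cases "t = 0") auto
  then show ?case using prime_ofD(6)[OF p] * 0 by blast
next
  case (Suc k)
  obtain l a t where *: "s = l + a / t" "l \<in> local_ideal_sum R P k" "a \<in> P (Suc k)"
    "t \<in> R - P (Suc k)" using Suc.prems by (auto simp: local_ideal_def)
  have p: "prime_of R (P (Suc k))" "prime_of R (P k)" using P Suc.prems(1) by auto
  have t0: "t \<noteq> 0" using * prime_ofD(2)[OF p(1)] by blast
  have e: "t * s - a = t * l" using * t0 by (simp add: field_simps)
  have a: "a \<in> R" using * prime_ofD(1)[OF p(1)] by blast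
  have "t * l \<in> local_ideal_sum R P k"
    using local_ideal_sum_smult[of k t l] * Suc.prems local_ideal_closed(6)[OF R p(2)] by auto
  moreover have "t * s - a \<in> R" using * Suc.prems is_subdomainD(2,3)[OF R] a by blast
  ultimately have "t * s - a \<in> P k" using Suc.IH Suc.prems(1) e by simp
  then have "t * s - a \<in> P (Suc k)"
    using P(2) Suc.prems(1) by (meson Suc_le_eq psubsetD)
  then have "(t * s - a) + a \<in> P (Suc k)" using * prime_ofD(4)[OF p(1)] by blast
  then have "t * s \<in> P (Suc k)" by simp
  then show ?case using prime_ofD(6)[OF p(1), of t s] *(4) Suc.prems(2) by blast
qed

lemma proper_local_ideal_sum: "proper_nonunital_algebra R (local_ideal_sum R P n)"
proof -
  have p: "prime_of R (P n)" using P by simp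
  have "1 \<notin> local_ideal_sum R P n"
    using local_ideal_sum_inter[of n 1] is_subdomainD(1)[OF R] prime_ofD(3)[OF p] by blast
  then show ?thesis
    unfolding proper_nonunital_algebra_def
    using zero_in_local_ideal_sum local_ideal_sum_add local_ideal_sum_mult local_ideal_sum_smult[of n]
      local_ideal_closed(6)[OF R p] by blast
qed

end

text \<open>The set is the radical of the ideal generated by \<open>x\<close>. Of two nonzero
  elements of \<open>V\<close> one divides the other; if \<open>z\<close> divides \<open>y\<close>,
  then \<open>(y + z) ^ k\<close> is a multiple of \<open>z ^ k\<close>, and
  \<open>y ^ (2 * k)\<close> is one of \<open>(y * z) ^ k\<close>.\<close>

lemma prime_of_radical:
  fixes V :: "'f::field set"
  assumes V: "is_subdomain V" and val: "\<And>x. x \<noteq> 0 \<Longrightarrow> x \<in> V \<or> inverse x \<in> V"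
    and x: "x \<noteq> 0" "inverse x \<notin> V"
  shows "prime_of V {y \<in> V. \<exists>k. y ^ k / x \<in> V}" (is "prime_of V ?Q")
proof -
  note D = is_subdomainD[OF V] is_subdomain_closed[OF V]
  have x_V: "x \<in> V" using val x by blast
  have cmp: "y / z \<in> V \<or> z / y \<in> V" if "y \<noteq> 0" "z \<noteq> 0" for y z
    using val[of "y / z"] that by simp
  have plus: "y + z \<in> ?Q" if "y \<in> V" "z \<in> ?Q" "z \<noteq> 0" "y / z \<in> V" for y z
  proof -
    obtain k where k: "z ^ k / x \<in> V" using \<open>z \<in> ?Q\<close> by blast
    have "(y + z) ^ k / x = (1 + y / z) ^ k * (z ^ k / x)"
      using \<open>z \<noteq> 0\<close> by (simp add: add_divide_eq_iff divide_simps power_divide add.commute)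
    also have "\<dots> \<in> V" using D(1,3,6,7) k that(4) by metis
    finally show ?thesis using D(6) that(1,2) by blast
  qed
  have pr: "y \<in> ?Q" if "y \<in> V" "z \<noteq> 0" "y * z \<in> ?Q" "y / z \<in> V" for y z
  proof -
    obtain k where k: "(y * z) ^ k / x \<in> V" using \<open>y * z \<in> ?Q\<close> by blast
    have "y ^ (2 * k) / x = (y / z) ^ k * ((y * z) ^ k / x)"
      using that(2) by (simp add: power_mult power2_eq_square power_mult_distrib power_divide)
    also have "\<dots> \<in> V" using D(3,7) k that(4) by blast
    finally show ?thesis using that(1) by blast
  qed
  have zero: "0 \<in> ?Q" using D(4) by (auto intro!: exI[of _ 1])
  have "1 \<notin> ?Q" using x(2) by (simp add: divide_inverse)
  moreover have "y + z \<in> ?Q" if "y \<in> ?Q" "z \<in> ?Q" for y z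
  proof (cases "y = 0 \<or> z = 0")
    case True
    then show ?thesis using that by auto
  next
    case False
    then show ?thesis using cmp[of y z] plus[of y z] plus[of z y] that by (auto simp: add.commute)
  qed
  moreover have "a * y \<in> ?Q" if "a \<in> V" "y \<in> ?Q" for a y
  proof -
    obtain k where k: "y ^ k / x \<in> V" using \<open>y \<in> ?Q\<close> by blast
    have "(a * y) ^ k / x = a ^ k * (y ^ k / x)" by (simp add: power_mult_distrib)
    also have "\<dots> \<in> V" using D(3,7) k that(1) by blast
    finally show ?thesis using D(3) that by blast
  qed
  moreover have "y \<in> ?Q \<or> z \<in> ?Q" if "y \<in> V" "z \<in> V" "y * z \<in> ?Q" for y z
  proof (cases "y = 0 \<or> z = 0")
    case True
    then show ?thesis using zero by blast
  next
    case False
    then show ?thesis using cmp[of y z] pr[of y z] pr[of z y] that by (auto simp: mult.commute)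
  qed
  ultimately show ?thesis
    unfolding prime_of_def using zero by (intro conjI ballI impI) (assumption | simp)+
qed

text \<open>With \<open>x i \<in> P (Suc i) - P i\<close>, all quotients \<open>x i / x (Suc i) ^ k\<close> lie in the maximal ideal of
  a suitable valuation ring, so that the radicals of the ideals generated by the \<open>x i\<close> are distinct.\<close>

lemma krull_dim_le_valuative_dim:
  fixes R :: "'f::field set"
  assumes R: "is_subdomain R" and quot: "quot_field R = UNIV"
  shows "krull_dim (subset_ring R) \<le> valuative_dim R"
proof (rule krull_dim_leI)
  fix n P assume "prime_chain (subset_ring R) n P"
  then have P: "\<forall>i\<le>n. prime_of R (P i)" "\<forall>i<n. P i \<subset> P (Suc i)"
    by (simp_all add: prime_chain_subset_ring_iff[OF R])
  let ?I = "local_ideal_sum R P n"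
  obtain V where V: "is_subdomain V" and RV: "R \<subseteq> V"
    and val: "\<And>x. x \<noteq> 0 \<Longrightarrow> x \<in> V \<or> inverse x \<in> V"
    and IV: "?I \<subseteq> V" and Inv: "\<And>x. x \<in> ?I \<Longrightarrow> inverse x \<in> V \<Longrightarrow> x = 0"
    using exists_valuation_ring[OF R proper_local_ideal_sum[OF R P]] by blast
  have "\<forall>i<n. \<exists>y. y \<in> P (Suc i) - P i" using P(2) by blast
  then obtain x where x: "\<And>i. i < n \<Longrightarrow> x i \<in> P (Suc i) - P i" by metis
  have p: "prime_of R (P i)" if "i \<le> n" for i using P(1) that by blast
  have x0: "x i \<noteq> 0" if "i < n" for i using x[OF that] prime_ofD(2)[OF p[of i]] that by auto
  have xR: "x i \<in> R" if "i < n" for i using x[OF that] prime_ofD(1)[OF p[of "Suc i"]] that by auto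
  have lI: "local_ideal R (P i) \<subseteq> ?I" if "i \<le> n" for i
    using local_ideal_subset_sum[OF R P, of n i] that by simp
  have xI: "x i \<in> ?I" if "i < n" for i
    using x[OF that] lI[of "Suc i"] local_ideal_closed(4)[OF R p[of "Suc i"]] that by auto
  \<comment> \<open>\<open>x (Suc i)\<close> is outside \<open>P (Suc i)\<close>, so its powers are
    admissible denominators in the localization there, while \<open>x i\<close> belongs to
    \<open>P (Suc i)\<close>.\<close>
  have quotI: "x i / x (Suc i) ^ k \<in> ?I" if "Suc i < n" for i k
  proof -
    have "x (Suc i) ^ k \<in> R - P (Suc i)"
      using prime_of_power[OF R p[of "Suc i"] xR[of "Suc i"]] x[of "Suc i"] xR[of "Suc i"] that
        is_subdomain_closed(4)[OF R] by auto
    then have "x i / x (Suc i) ^ k \<in> local_ideal R (P (Suc i))"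
      using x[of i] that unfolding local_ideal_def by auto
    then show ?thesis using lI[of "Suc i"] that by auto
  qed
  \<comment> \<open>The zero ideal is put in front because the \<open>n\<close> radicals alone would
    give a chain that is one prime too short.\<close>
  define Q where "Q i = (case i of 0 \<Rightarrow> {0} | Suc j \<Rightarrow> {y \<in> V. \<exists>k. y ^ k / x j \<in> V})" for i
  have "prime_of V (Q i)" if "i \<le> n" for i
  proof (cases i)
    case 0
    then show ?thesis using prime_of_zero[OF V] by (simp add: Q_def)
  next
    case (Suc j)
    then have j: "j < n" using that by simp
    show ?thesis using prime_of_radical[OF V val x0[OF j]] Inv[OF xI[OF j]] x0[OF j] Suc by (auto simp: Q_def)
  qed
  moreover have "Q i \<subset> Q (Suc i)" if "i < n" for i
  proof -
    have xQ: "x i \<in> Q (Suc i)"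
      using x0[OF that] xR[OF that] RV is_subdomainD(1)[OF V]
      by (auto simp: Q_def intro!: exI[of _ 1])
    show ?thesis
    proof (cases i)
      case 0
      have "0 \<in> Q (Suc i)" using is_subdomain_closed(1)[OF V] by (auto simp: Q_def intro!: exI[of _ 1])
      then show ?thesis using 0 xQ x0[OF that] by (auto simp: Q_def)
    next
      case (Suc j)
      then have j: "Suc j < n" using that by simp
      have "Q (Suc j) \<subseteq> Q (Suc i)"
      proof
        fix y assume "y \<in> Q (Suc j)"
        then obtain k where k: "y \<in> V" "y ^ k / x j \<in> V" by (auto simp: Q_def)
        have "x j / x i \<in> V" using quotI[OF j, of 1] IV Suc by auto
        then have "(y ^ k / x j) * (x j / x i) \<in> V" using k is_subdomainD(3)[OF V] by blast
        then have "y ^ k / x i \<in> V" using x0[of j] j by simp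
        then show "y \<in> Q (Suc i)" using k(1) by (auto simp: Q_def)
      qed
      \<comment> \<open>Membership would mean that \<open>x j\<close> divides some power of
        \<open>x i\<close>; the nonzero element \<open>x j / x i ^ k\<close> of \<open>?I\<close>
        would then be a unit. This is why \<open>quotI\<close> covers all exponents.\<close>
      moreover have "x i \<notin> Q (Suc j)"
      proof
        assume "x i \<in> Q (Suc j)"
        then obtain k where k: "x i ^ k / x j \<in> V" by (auto simp: Q_def)
        have "x j / x i ^ k = 0" using Inv[OF quotI[OF j, of k]] k Suc by simp
        then show False using x0[of j] x0[of i] that j by simp
      qed
      ultimately show ?thesis using xQ Suc by auto
    qed
  qed
  ultimately have "prime_chain (subset_ring V) n Q" by (simp add: prime_chain_subset_ring_iff[OF V])
  then have "enat n \<le> krull_dim (subset_ring V)" by (rule krull_dim_geI)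
  also have "\<dots> \<le> valuative_dim R"
    unfolding valuative_dim_def
    by (rule Sup_upper) (use valuation_overringI[OF quot RV V val] in auto)
  finally show "enat n \<le> valuative_dim R" .
qed

section \<open>Valuation rings of a rational function field\<close>

text \<open>Gaussian elimination on the coefficient of highest index. The family is indexed by a
  set, so that coinciding polynomials count separately.\<close>

lemma poly_linear_dependence:
  fixes f :: "'a \<Rightarrow> 'k::field poly"
  assumes "finite S" "d < card S" "\<And>s i. s \<in> S \<Longrightarrow> d \<le> i \<Longrightarrow> coeff (f s) i = 0"
  shows "\<exists>a. (\<exists>s\<in>S. a s \<noteq> 0) \<and> (\<Sum>s\<in>S. Polynomial.smult (a s) (f s)) = 0"
  using assms
proof (induction d arbitrary: S f)
  case 0
  then have "f s = 0" if "s \<in> S" for s using that by (simp add: poly_eq_iff)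
  moreover have "S \<noteq> {}" using 0 by auto
  ultimately show ?case by (intro exI[of _ "\<lambda>_. 1"]) auto
next
  case (Suc d)
  show ?case
  proof (cases "\<forall>s\<in>S. coeff (f s) d = 0")
    case True
    have "coeff (f s) i = 0" if "s \<in> S" "d \<le> i" for s i
      using True Suc.prems(3)[OF that(1), of i] that by (cases "i = d") auto
    then show ?thesis using Suc.IH[of S f] Suc.prems(1,2) by simp
  next
    case False
    then obtain r where r: "r \<in> S" "coeff (f r) d \<noteq> 0" by blast
    let ?c = "\<lambda>s. coeff (f s) d / coeff (f r) d"
    let ?g = "\<lambda>s. f s - Polynomial.smult (?c s) (f r)"
    have "coeff (?g s) i = 0" if "s \<in> S - {r}" "d \<le> i" for s i
      using Suc.prems(3)[of s i] Suc.prems(3)[of r i] that r by (cases "i = d") auto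
    moreover have "d < card (S - {r})" using Suc.prems(1,2) r(1) by simp
    ultimately obtain a where a: "\<exists>s\<in>S - {r}. a s \<noteq> 0"
        "(\<Sum>s\<in>S - {r}. Polynomial.smult (a s) (?g s)) = 0"
      using Suc.IH[of "S - {r}" ?g] Suc.prems(1) by blast
    \<comment> \<open>The coefficient of the pivot \<open>f r\<close> cancels the multiples of it
      that were subtracted in \<open>?g\<close>.\<close>
    let ?b = "\<lambda>s. if s = r then - (\<Sum>s\<in>S - {r}. a s * ?c s) else a s"
    have "(\<Sum>s\<in>S. Polynomial.smult (?b s) (f s)) =
        Polynomial.smult (?b r) (f r) + (\<Sum>s\<in>S - {r}. Polynomial.smult (?b s) (f s))"
      by (rule sum.remove[OF Suc.prems(1) r(1)])
    also have "(\<Sum>s\<in>S - {r}. Polynomial.smult (?b s) (f s)) =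
        (\<Sum>s\<in>S - {r}. Polynomial.smult (a s) (?g s) + Polynomial.smult (a s * ?c s) (f r))"
      by (rule sum.cong) (auto simp: smult_diff_right)
    also have "\<dots> = Polynomial.smult (\<Sum>s\<in>S - {r}. a s * ?c s) (f r)"
      unfolding sum.distrib a(2) by (simp add: smult_sum)
    finally have "(\<Sum>s\<in>S. Polynomial.smult (?b s) (f s)) = 0" by simp
    moreover have "\<exists>s\<in>S. ?b s \<noteq> 0" using a(1) by auto
    ultimately show ?thesis by (intro exI[of _ ?b]) blast
  qed
qed

section \<open>Constants of the rational function field\<close>

definition const_fract :: "'k::field \<Rightarrow> 'k poly fract" where
  "const_fract c = to_fract [:c:]"

lemma const_fract_hom [simp]:
  fixes b c :: "'k::field"
  shows "const_fract (0 :: 'k) = 0" "const_fract (1::'k) = 1" "const_fract (b + c) = const_fract b + const_fract c"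
  "const_fract (b - c) = const_fract b - const_fract c"
  "const_fract (b * c) = const_fract b * const_fract c"
  "const_fract c = 0 \<longleftrightarrow> c = 0"
proof -
  show "const_fract (1::'k) = 1" by (simp add: const_fract_def one_pCons[symmetric])
  have "[:b + c:] = [:b:] + [:c:]" "[:b - c:] = [:b:] - [:c:]" "[:b * c:] = [:b:] * [:c:]" by simp_all
  then show "const_fract (b + c) = const_fract b + const_fract c"
    "const_fract (b - c) = const_fract b - const_fract c"
    "const_fract (b * c) = const_fract b * const_fract c"
    unfolding const_fract_def by (metis to_fract_add to_fract_diff to_fract_mult)+
qed (simp_all add: const_fract_def)

lemma const_fract_inverse [simp]: "const_fract (inverse c) = inverse (const_fract c)"
proof (cases "c = 0")
  case False
  have "const_fract c * const_fract (inverse c) = 1"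
    using False by (simp flip: const_fract_hom(5))
  then show ?thesis by (rule inverse_unique[symmetric])
qed simp

lemma const_fract_divide [simp]: "const_fract (b / c) = const_fract b / const_fract c"
  by (simp add: divide_inverse)

lemma to_fract_power: "to_fract (p ^ n) = to_fract p ^ n"
  by (induction n) simp_all

lemma to_fract_smult: "to_fract (Polynomial.smult c p) = const_fract c * to_fract p"
  by (simp add: const_fract_def flip: to_fract_mult)

text \<open>Two elements of the rational function field are algebraically dependent over the constants:
  after clearing denominators, the monomials of degree at most \<open>N\<close> in each of them are more
  numerous than the coefficients of a polynomial whose degree is linear in \<open>N\<close>.\<close>

lemma algebraic_dependence_fract:
  fixes x y :: "'k::field poly fract"
  obtains c :: "nat \<times> nat \<Rightarrow> 'k" and S :: "(nat \<times> nat) set" where "finite S" "S \<noteq> {}"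
    "\<And>s. s \<in> S \<Longrightarrow> c s \<noteq> 0" "(\<Sum>(k, l)\<in>S. const_fract (c (k, l)) * x ^ k * y ^ l) = 0"
proof -
  obtain p1 q1 where x: "x = Fract p1 q1" "q1 \<noteq> 0" by (cases x) auto
  obtain p2 q2 where y: "y = Fract p2 q2" "q2 \<noteq> 0" by (cases y) auto
  \<comment> \<open>After multiplication by \<open>q1 ^ N * q2 ^ N\<close> the monomials have degree
    at most \<open>2 * N * m\<close>. With \<open>N = 2 * m\<close> their number
    \<open>(N + 1) ^ 2\<close> exceeds \<open>2 * N * m + 1\<close> by \<open>4 * m\<close>, and
    \<open>Suc\<close> makes this positive.\<close>
  define m where "m = Suc (degree p1 + degree q1 + degree p2 + degree q2)"
  define N where "N = 2 * m"
  define f where "f = (\<lambda>(k, l). p1 ^ k * q1 ^ (N - k) * (p2 ^ l * q2 ^ (N - l)))"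
  let ?S = "{..N} \<times> {..N}"
  have deg1: "degree (p ^ k * q ^ (N - k)) \<le> N * m"
    if "degree p \<le> m" "degree q \<le> m" "k \<le> N" for p q :: "'k poly" and k
  proof -
    have "degree (p ^ k * q ^ (N - k)) \<le> degree (p ^ k) + degree (q ^ (N - k))"
      by (rule degree_mult_le)
    also have "\<dots> \<le> degree p * k + degree q * (N - k)"
      by (intro add_mono degree_power_le)
    also have "\<dots> \<le> m * k + m * (N - k)" using that by (intro add_mono mult_right_mono) auto
    also have "\<dots> = m * (k + (N - k))" by (rule distrib_left[symmetric])
    also have "\<dots> = N * m" using that(3) by simp
    finally show ?thesis .
  qed
  have "degree (f s) \<le> 2 * N * m" if "s \<in> ?S" for s
  proof -
    obtain k l where s: "s = (k, l)" "k \<le> N" "l \<le> N" using \<open>s \<in> ?S\<close> by auto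
    have "degree (f s) \<le> degree (p1 ^ k * q1 ^ (N - k)) + degree (p2 ^ l * q2 ^ (N - l))"
      unfolding f_def s(1) prod.case by (rule degree_mult_le)
    also have "\<dots> \<le> N * m + N * m"
      by (intro add_mono deg1) (use s in \<open>auto simp: m_def\<close>)
    finally show ?thesis by simp
  qed
  then have "coeff (f s) i = 0" if "s \<in> ?S" "2 * N * m + 1 \<le> i" for s i
    using that by (intro coeff_eq_0) (meson add_leD1 less_le_trans less_add_one le_less_trans)
  moreover have "2 * N * m + 1 < card ?S"
    by (simp add: card_cartesian_product N_def m_def algebra_simps)
  ultimately obtain a where a: "\<exists>s\<in>?S. a s \<noteq> 0" "(\<Sum>s\<in>?S. Polynomial.smult (a s) (f s)) = 0"
    using poly_linear_dependence[of ?S "2 * N * m + 1" f] by auto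
  define d where "d = to_fract q1 ^ N * to_fract q2 ^ N"
  have d0: "d \<noteq> 0" using x y by (simp add: d_def)
  have f_eq: "to_fract (f (k, l)) = d * (x ^ k * y ^ l)" if "k \<le> N" "l \<le> N" for k l
  proof -
    have "to_fract q ^ (N - k) * to_fract p ^ k = to_fract q ^ N * Fract p q ^ k"
      if "q \<noteq> 0" "k \<le> N" for p q :: "'k poly" and k
    proof -
      have "to_fract q ^ N = to_fract q ^ (N - k) * to_fract q ^ k"
        using that by (simp flip: power_add)
      then show ?thesis
        using that by (simp add: Fract_conv_to_fract power_divide)
    qed
    note e = this[OF x(2) that(1), of p1] this[OF y(2) that(2), of p2]
    have "to_fract (f (k, l)) = (to_fract q1 ^ (N - k) * to_fract p1 ^ k) *
        (to_fract q2 ^ (N - l) * to_fract p2 ^ l)"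
      by (simp add: f_def to_fract_power mult_ac)
    then show ?thesis unfolding e x(1) y(1) d_def by (simp only: mult_ac)
  qed
  have "0 = to_fract (\<Sum>s\<in>?S. Polynomial.smult (a s) (f s))" using a(2) by simp
  also have "\<dots> = (\<Sum>(k, l)\<in>?S. const_fract (a (k, l)) * (d * (x ^ k * y ^ l)))"
    unfolding to_fract_sum to_fract_smult by (rule sum.cong) (auto simp: f_eq)
  also have "\<dots> = d * (\<Sum>(k, l)\<in>?S. const_fract (a (k, l)) * x ^ k * y ^ l)"
    unfolding sum_distrib_left by (rule sum.cong) (auto simp: mult_ac)
  finally have "(\<Sum>(k, l)\<in>?S. const_fract (a (k, l)) * x ^ k * y ^ l) = 0" using d0 by simp
  moreover have "(\<Sum>(k, l)\<in>?S. const_fract (a (k, l)) * x ^ k * y ^ l) =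
      (\<Sum>(k, l)\<in>{s\<in>?S. a s \<noteq> 0}. const_fract (a (k, l)) * x ^ k * y ^ l)"
    by (rule sum.mono_neutral_right) auto
  ultimately show ?thesis
    using that[of "{s\<in>?S. a s \<noteq> 0}" a] a(1) by fastforce
qed

text \<open>The nonunits of a valuation ring are closed under subtraction, so
  \<open>u = (u + r) - r\<close> could not be a unit if \<open>u + r\<close> were a nonunit. The
  proof compares \<open>r\<close> with \<open>u + r\<close> directly.\<close>

lemma valuation_unit_plus_nonunit:
  fixes V :: "'f::field set"
  assumes V: "is_subdomain V" and val: "\<And>x. x \<noteq> 0 \<Longrightarrow> x \<in> V \<or> inverse x \<in> V"
    and u: "u \<in> V" "inverse u \<in> V" "u \<noteq> 0" and r: "r \<in> V" "inverse r \<notin> V"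
  shows "u + r \<in> V" "inverse (u + r) \<in> V" "u + r \<noteq> 0"
proof -
  note D = is_subdomainD[OF V] is_subdomain_closed[OF V]
  show "u + r \<in> V" by (rule D(6)[OF u(1) r(1)])
  have r0: "r \<noteq> 0" using r D(4) by auto
  show nz: "u + r \<noteq> 0"
  proof
    assume "u + r = 0"
    then have "r = - u" by (simp add: add_eq_0_iff)
    then show False using r(2) D(5)[OF u(2)] by simp
  qed
  show "inverse (u + r) \<in> V"
  proof (cases "r / (u + r) \<in> V")
    case True
    have "inverse (u + r) = inverse u * (1 - r / (u + r))" using nz u(3) by (simp add: field_simps)
    then show ?thesis using D(3)[OF u(2) D(2)[OF D(1) True]] by simp
  next
    case False
    then have "(u + r) / r \<in> V" using val[of "r / (u + r)"] nz r0 by simp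
    then have "inverse u * ((u + r) / r - 1) \<in> V" by (intro D(1-3) u(2))
    moreover have "inverse u * ((u + r) / r - 1) = inverse r" using r0 u(3) by (simp add: field_simps)
    ultimately show ?thesis using r(2) by simp
  qed
qed

text \<open>By \<open>dist\<close> the terms have pairwise different values, and the term of least
  value (written additively) determines that of the sum. In the induction the new term is compared
  with the dominant one so far; after division by the winner, the other contribution is a
  nonunit.\<close>

lemma valuation_dominant_term:
  fixes V :: "'f::field set"
  assumes V: "is_subdomain V" and val: "\<And>x. x \<noteq> 0 \<Longrightarrow> x \<in> V \<or> inverse x \<in> V"
    and S: "finite S" "S \<noteq> {}" "\<And>s. s \<in> S \<Longrightarrow> t s \<noteq> 0"
    and dist: "\<And>r s. r \<in> S \<Longrightarrow> s \<in> S \<Longrightarrow> r \<noteq> s \<Longrightarrow> \<not> (t r / t s \<in> V \<and> t s / t r \<in> V)"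
  shows "\<exists>r\<in>S. (\<Sum>s\<in>S. t s) / t r \<in> V \<and> inverse ((\<Sum>s\<in>S. t s) / t r) \<in> V \<and> (\<Sum>s\<in>S. t s) \<noteq> 0"
  using S dist
proof (induction S rule: finite_ne_induct)
  case (singleton s)
  then show ?case using is_subdomainD(1)[OF V] by simp
next
  case (insert s F)
  note D = is_subdomainD[OF V] is_subdomain_closed[OF V]
  let ?T = "\<Sum>s\<in>F. t s"
  obtain r where r: "r \<in> F" "?T / t r \<in> V" "inverse (?T / t r) \<in> V" "?T \<noteq> 0"
    using insert.IH insert.prems by blast
  have nz: "t r \<noteq> 0" "t s \<noteq> 0" and rs: "r \<noteq> s" using insert.prems(1) insert.hyps r(1) by auto
  have sum: "(\<Sum>s\<in>insert s F. t s) = t s + ?T" using insert.hyps by simp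
  have d: "\<not> (t r / t s \<in> V \<and> t s / t r \<in> V)" using insert.prems(2) r(1) rs by blast
  show ?case
  proof (cases "t s / t r \<in> V")
    case True
    then have "inverse (t s / t r) \<notin> V" using d by simp
    from valuation_unit_plus_nonunit[OF V val r(2,3) _ True this]
    have "?T / t r + t s / t r \<in> V \<and> inverse (?T / t r + t s / t r) \<in> V \<and> ?T / t r + t s / t r \<noteq> 0"
      using r(4) nz by simp
    moreover have "?T / t r + t s / t r = (t s + ?T) / t r" by (simp add: add_divide_distrib)
    ultimately show ?thesis unfolding sum using r(1) by auto
  next
    case False
    then have 1: "t r / t s \<in> V" using val[of "t s / t r"] nz by auto
    have 2: "?T / t s = (?T / t r) * (t r / t s)" using nz by simp
    have 3: "t s / t r = inverse (?T / t s) * (?T / t r)" using nz r(4) by (simp add: field_simps)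
    have "?T / t s \<in> V" "inverse (?T / t s) \<notin> V"
      using D(3)[OF r(2) 1] D(3)[OF _ r(2), of "inverse (?T / t s)"] False
      unfolding 2[symmetric] 3[symmetric] by blast+
    from valuation_unit_plus_nonunit[OF V val D(1) _ _ this]
    have "1 + ?T / t s \<in> V \<and> inverse (1 + ?T / t s) \<in> V \<and> 1 + ?T / t s \<noteq> 0" using D(1) by simp
    moreover have "1 + ?T / t s = (t s + ?T) / t s" using nz by (simp add: add_divide_distrib)
    ultimately show ?thesis unfolding sum by auto
  qed
qed

text \<open>The units of the localization of \<open>V\<close> at \<open>Q\<close>; for a valuation ring they correspond to a convex
  subgroup of the value group.\<close>

definition local_units :: "'f::field set \<Rightarrow> 'f set \<Rightarrow> 'f set" where
  "local_units V Q = {a / b |a b. a \<in> V - Q \<and> b \<in> V - Q}"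

lemma local_units_closed:
  fixes V :: "'f::field set"
  assumes V: "is_subdomain V" and Q: "prime_of V Q"
  shows "\<And>x y. x \<in> local_units V Q \<Longrightarrow> y \<in> local_units V Q \<Longrightarrow> x * y \<in> local_units V Q"
    "\<And>x. x \<in> local_units V Q \<Longrightarrow> inverse x \<in> local_units V Q"
    "\<And>x y. x \<in> local_units V Q \<Longrightarrow> y \<in> local_units V Q \<Longrightarrow> x / y \<in> local_units V Q"
    "\<And>x n. x \<in> local_units V Q \<Longrightarrow> x ^ n \<in> local_units V Q"
    "V - Q \<subseteq> local_units V Q"
    "\<And>x. x \<in> local_units V Q \<Longrightarrow> x \<notin> Q"
    "\<And>x. x \<in> V \<Longrightarrow> inverse x \<in> V \<Longrightarrow> x \<noteq> 0 \<Longrightarrow> x \<in> local_units V Q"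
proof -
  note D = prime_ofD[OF Q]
  have mult: "s * t \<in> V - Q" if "s \<in> V - Q" "t \<in> V - Q" for s t
    using that D(6) is_subdomainD(3)[OF V] by blast
  have one: "1 \<in> V - Q" using D(3) is_subdomainD(1)[OF V] by blast
  show m: "x * y \<in> local_units V Q" if "x \<in> local_units V Q" "y \<in> local_units V Q" for x y
  proof -
    obtain a b c d where *: "x = a / b" "y = c / d" "a \<in> V - Q" "b \<in> V - Q" "c \<in> V - Q" "d \<in> V - Q"
      using \<open>x \<in> local_units V Q\<close> \<open>y \<in> local_units V Q\<close> unfolding local_units_def by blast
    have "x * y = (a * c) / (b * d)" using * by simp
    then show ?thesis using mult * unfolding local_units_def by blast
  qed
  show i: "inverse x \<in> local_units V Q" if x: "x \<in> local_units V Q" for x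
  proof -
    obtain a b where *: "x = a / b" "a \<in> V - Q" "b \<in> V - Q"
      using x unfolding local_units_def by blast
    have "inverse x = b / a" using * by simp
    then show ?thesis using * unfolding local_units_def by blast
  qed
  show "x / y \<in> local_units V Q" if "x \<in> local_units V Q" "y \<in> local_units V Q" for x y
    using m[OF that(1) i[OF that(2)]] by (simp add: divide_inverse)
  show s: "V - Q \<subseteq> local_units V Q"
  proof
    fix x assume "x \<in> V - Q"
    moreover have "x = x / 1" by simp
    ultimately show "x \<in> local_units V Q" using one unfolding local_units_def by blast
  qed
  show "x ^ n \<in> local_units V Q" if "x \<in> local_units V Q" for x n
    using that s one m by (induction n) auto
  show "x \<notin> Q" if x: "x \<in> local_units V Q" for x
  proof
    assume xQ: "x \<in> Q"
    obtain a b where *: "x = a / b" "a \<in> V - Q" "b \<in> V - Q"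
      using x unfolding local_units_def by blast
    have "b \<noteq> 0" using * D(2) by blast
    then have "a = b * x" using * by simp
    then show False using D(5)[of b x] * xQ by blast
  qed
  show "x \<in> local_units V Q" if "x \<in> V" "inverse x \<in> V" "x \<noteq> 0" for x
  proof -
    have "x \<notin> Q" using D(3) D(5)[OF that(2), of x] that(3) by auto
    then show ?thesis using s that(1) by blast
  qed
qed

lemma local_units_antimono: "Q \<subseteq> Q' \<Longrightarrow> local_units V Q' \<subseteq> local_units V Q"
  unfolding local_units_def by blast

text \<open>Abhyankar's inequality in transcendence degree one: modulo the convex subgroups of the value
  group belonging to the \<open>Q\<close>s, the values of \<open>x \<in> Q2 - Q1\<close> and \<open>y \<in> Q4 - Q3\<close> are independent of each
  other and of the values of constants, so no two monomials in \<open>x\<close> and \<open>y\<close> have the same value.\<close>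

lemma at_most_one_collapse:
  fixes W :: "'k::field poly fract set"
  assumes W: "is_subdomain W" and val: "\<And>x. x \<noteq> 0 \<Longrightarrow> x \<in> W \<or> inverse x \<in> W"
    and Q: "prime_of W Q1" "prime_of W Q2" "prime_of W Q3" "prime_of W Q4"
    and le: "Q1 \<subset> Q2" "Q2 \<subseteq> Q3" "Q3 \<subset> Q4"
    and c12: "\<And>c. const_fract c \<in> Q2 \<Longrightarrow> const_fract c \<in> Q1"
    and c34: "\<And>c. const_fract c \<in> Q4 \<Longrightarrow> const_fract c \<in> Q3"
  shows False
proof -
  obtain x where x: "x \<in> Q2" "x \<notin> Q1" using le by blast
  obtain y where y: "y \<in> Q4" "y \<notin> Q3" using le by blast
  have xW: "x \<in> W" and yW: "y \<in> W" using x y prime_ofD(1)[OF Q(2)] prime_ofD(1)[OF Q(4)] by auto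
  have x0: "x \<noteq> 0" and y0: "y \<noteq> 0" using x y prime_ofD(2)[OF Q(1)] prime_ofD(2)[OF Q(3)] by auto
  note U1 = local_units_closed[OF W Q(1)] and U2 = local_units_closed[OF W Q(2)]
    and U3 = local_units_closed[OF W Q(3)] and U4 = local_units_closed[OF W Q(4)]
  have U32: "local_units W Q3 \<subseteq> local_units W Q2" and U21: "local_units W Q2 \<subseteq> local_units W Q1"
    using le local_units_antimono by blast+
  have xU: "x \<in> local_units W Q1" and yU: "y \<in> local_units W Q3"
    using x y xW yW U1(5) U3(5) by blast+
  then have yU2: "y \<in> local_units W Q2" and yU1: "y \<in> local_units W Q1" using U32 U21 by blast+
  \<comment> \<open>A constant or its inverse lies in \<open>W\<close>. Being a unit at
    \<open>Q\<close>, neither lies in \<open>Q\<close>, hence neither lies in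
    \<open>Q'\<close>.\<close>
  have const: "const_fract c \<in> local_units W Q'"
    if Q: "prime_of W Q" "prime_of W Q'" and c: "const_fract c \<in> local_units W Q"
      and imp: "\<And>c. const_fract c \<in> Q' \<Longrightarrow> const_fract c \<in> Q" for Q Q' c
  proof -
    note U = local_units_closed[OF W Q(1)] and U' = local_units_closed[OF W Q(2)]
    have c0: "const_fract c \<noteq> 0" using U(6)[OF c] prime_ofD(2)[OF Q(1)] by auto
    from val[OF this] show ?thesis
    proof
      assume "const_fract c \<in> W"
      then show ?thesis using U(6)[OF c] imp U'(5) by blast
    next
      assume *: "inverse (const_fract c) \<in> W"
      have "const_fract (inverse c) \<notin> Q'" using imp[of "inverse c"] U(6)[OF U(2)[OF c]] by auto
      then have "inverse (const_fract c) \<in> local_units W Q'" using * U'(5) by auto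
      from U'(2)[OF this] show ?thesis by simp
    qed
  qed
  have pow: "z ^ m \<notin> local_units W Q" if "prime_of W Q" "z \<in> Q" "m \<noteq> 0" for Q z m
  proof -
    have "z \<in> W" using prime_ofD(1)[OF that(1)] that(2) by blast
    then have "z ^ (m - 1) * z \<in> Q"
      using prime_ofD(5)[OF that(1)] is_subdomain_closed(4)[OF W] that(2) by blast
    then have "z ^ m \<in> Q" using that(3) by (cases m) (auto simp: mult.commute)
    then show ?thesis using local_units_closed(6)[OF W that(1)] by blast
  qed
  \<comment> \<open>\<open>u\<close> is the unit by which two monomials of equal value differ. If
    the exponents of \<open>x\<close> differ, a power of \<open>x\<close> equals a constant times
    units at \<open>Q1\<close> and \<open>Q2\<close>, for \<open>y\<close> is outside
    \<open>Q3\<close> and so outside both. The constant is then a unit at \<open>Q1\<close>, by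
    \<open>const\<close> also at \<open>Q2\<close>, and so would be that power of \<open>x\<close>,
    although \<open>x\<close> lies in \<open>Q2\<close>. For equal exponents of \<open>x\<close> the
    same happens with \<open>y\<close>, \<open>Q3\<close> and \<open>Q4\<close>.\<close>
  have no_rel: False
    if u: "u \<in> W" "inverse u \<in> W" and c: "c \<noteq> 0" and kl: "k' < k \<or> (k = k' \<and> l' < l)"
      and rel: "x ^ k * y ^ l = u * const_fract c * (x ^ k' * y ^ l')" for u c k l k' l'
  proof -
    have u0: "u \<noteq> 0" using rel x0 y0 by auto
    have uU: "u \<in> local_units W Q" if "prime_of W Q" for Q
      using local_units_closed(7)[OF W that u u0] .
    from kl show False
    proof
      assume k: "k' < k"
      have "x ^ k = x ^ (k - k') * x ^ k'" using k by (simp flip: power_add)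
      then have eq: "x ^ (k - k') = u * const_fract c * (y ^ l' / y ^ l)"
        using rel x0 y0 by (simp add: field_simps)
      then have "const_fract c = x ^ (k - k') / (u * (y ^ l' / y ^ l))" using u0 y0 by (simp add: field_simps)
      also have "\<dots> \<in> local_units W Q1"
        by (intro U1(1,3,4) xU uU Q(1) yU1)
      finally have cU: "const_fract c \<in> local_units W Q2" using const[OF Q(1,2) _ c12] by blast
      have "u * const_fract c * (y ^ l' / y ^ l) \<in> local_units W Q2"
        by (intro U2(1,3,4) uU Q(2) cU yU2)
      then show False using pow[OF Q(2) x(1), of "k - k'"] eq k by simp
    next
      assume l: "k = k' \<and> l' < l"
      have "y ^ l = y ^ (l - l') * y ^ l'" using l by (simp flip: power_add)
      then have eq: "y ^ (l - l') = u * const_fract c" using rel x0 y0 l by (simp add: field_simps)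
      then have "const_fract c = y ^ (l - l') / u" using u0 by (simp add: field_simps)
      also have "\<dots> \<in> local_units W Q3" by (intro U3(3,4) yU uU Q(3))
      finally have "const_fract c \<in> local_units W Q4" using const[OF Q(3,4) _ c34] by blast
      then have "u * const_fract c \<in> local_units W Q4" using U4(1) uU[OF Q(4)] by blast
      then show False using pow[OF Q(4) y(1), of "l - l'"] eq l by simp
    qed
  qed
  obtain c S where S: "finite S" "S \<noteq> {}" "\<And>s. s \<in> S \<Longrightarrow> c s \<noteq> 0"
    and sum: "(\<Sum>(k, l)\<in>S. const_fract (c (k, l)) * x ^ k * y ^ l) = 0"
    by (rule algebraic_dependence_fract[of x y]) (rule that)
  define t where "t = (\<lambda>(k, l). const_fract (c (k, l)) * x ^ k * y ^ l)"
  have t0: "t s \<noteq> 0" if "s \<in> S" for s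
    using S(3)[OF that] x0 y0 by (cases s) (simp add: t_def)
  have "\<exists>r\<in>S. \<exists>s\<in>S. r \<noteq> s \<and> t r / t s \<in> W \<and> t s / t r \<in> W"
  proof (rule ccontr)
    assume "\<not> ?thesis"
    then have "\<exists>r\<in>S. (\<Sum>s\<in>S. t s) / t r \<in> W \<and> inverse ((\<Sum>s\<in>S. t s) / t r) \<in> W \<and> (\<Sum>s\<in>S. t s) \<noteq> 0"
      by (intro valuation_dominant_term[OF W val S(1,2) t0]) auto
    then show False using sum by (simp add: t_def)
  qed
  then obtain k l k' l' where
    *: "(k, l) \<in> S" "(k', l') \<in> S" "(k, l) \<noteq> (k', l')"
      "t (k, l) / t (k', l') \<in> W" "t (k', l') / t (k, l) \<in> W" by force
  have **: False if "(k, l) \<in> S" "(k', l') \<in> S" "k' < k \<or> (k = k' \<and> l' < l)"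
      "t (k, l) / t (k', l') \<in> W" "t (k', l') / t (k, l) \<in> W" for k l k' l'
  proof (rule no_rel[OF that(4) _ _ that(3)])
    show "inverse (t (k, l) / t (k', l')) \<in> W" using that(5) by simp
    show "c (k', l') / c (k, l) \<noteq> 0" using S(3) that(1,2) by simp
    show "x ^ k * y ^ l = t (k, l) / t (k', l') * const_fract (c (k', l') / c (k, l)) * (x ^ k' * y ^ l')"
      using S(3)[OF that(1)] S(3)[OF that(2)] x0 y0 by (simp add: t_def)
  qed
  consider "k' < k \<or> (k = k' \<and> l' < l)" | "k < k' \<or> (k' = k \<and> l < l')"
    using *(3) by fastforce
  then show False using **[OF *(1,2)] **[OF *(2,1)] *(4,5) by cases blast+
qed

section \<open>Contraction of valuation rings and their primes to the constants\<close>

definition const_part :: "'k::field poly fract set \<Rightarrow> 'k set" where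
  "const_part W = {c. const_fract c \<in> W}"

lemma is_subdomain_const_part:
  assumes "is_subdomain W"
  shows "is_subdomain (const_part W)"
  using is_subdomainD[OF assms] by (intro is_subdomainI) (auto simp: const_part_def)

lemma prime_of_const_part:
  assumes "prime_of W Q"
  shows "prime_of (const_part W) (const_part Q)"
  using prime_ofD[OF assms] unfolding prime_of_def const_part_def by auto

lemma krull_dim_le_const_part:
  fixes W :: "'k::field poly fract set"
  assumes W: "is_subdomain W" and val: "\<And>x. x \<noteq> 0 \<Longrightarrow> x \<in> W \<or> inverse x \<in> W"
  shows "krull_dim (subset_ring W) \<le> eSuc (krull_dim (subset_ring (const_part W)))"
proof (rule krull_dim_leI)
  fix n Q assume "prime_chain (subset_ring W) n Q"
  then have Q: "\<forall>i\<le>n. prime_of W (Q i)" "\<forall>i<n. Q i \<subset> Q (Suc i)"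
    by (simp_all add: prime_chain_subset_ring_iff[OF W])
  let ?V = "const_part W"
  note V = is_subdomain_const_part[OF W]
  define P where "P i = const_part (Q i)" for i
  have P: "prime_of ?V (P i)" if "i \<le> n" for i
    using that Q(1) prime_of_const_part unfolding P_def by blast
  have P_mono: "P i \<subseteq> P (Suc i)" if "i < n" for i
    using that Q(2) unfolding P_def const_part_def by blast
  have jump: "P i \<subset> P (Suc i)" if "i \<noteq> j" "i < n" "j < n" "P j = P (Suc j)" for i j
  proof (rule ccontr)
    assume "\<not> P i \<subset> P (Suc i)"
    then have eq: "P i = P (Suc i)" using P_mono[of i] that by blast
    have *: False if "a < b" "b < n" "P a = P (Suc a)" "P b = P (Suc b)" for a b
    proof (rule at_most_one_collapse[OF W val])
      show "prime_of W (Q a)" "prime_of W (Q (Suc a))" "prime_of W (Q b)" "prime_of W (Q (Suc b))"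
        "Q a \<subset> Q (Suc a)" "Q b \<subset> Q (Suc b)" using Q that by auto
      show "Q (Suc a) \<subseteq> Q b" by (rule chain_mono[OF Q(2)]) (use that in auto)
      show "const_fract c \<in> Q (Suc a) \<Longrightarrow> const_fract c \<in> Q a"
        "const_fract c \<in> Q (Suc b) \<Longrightarrow> const_fract c \<in> Q b" for c
        using that(3,4) unfolding P_def const_part_def by blast+
    qed
    show False
      using *[of i j] *[of j i] that eq by (metis nat_neq_iff)
  qed
  show "enat n \<le> eSuc (krull_dim (subset_ring ?V))"
  proof (cases "\<exists>j<n. P j = P (Suc j)")
    case False
    then have "prime_chain (subset_ring ?V) n P"
      unfolding prime_chain_subset_ring_iff[OF V] using P P_mono by blast
    then have "enat n \<le> krull_dim (subset_ring ?V)" by (rule krull_dim_geI)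
    then show ?thesis using ile_eSuc order_trans by blast
  next
    case True
    then obtain j where j: "j < n" "P j = P (Suc j)" by blast
    then obtain m where m: "n = Suc m" by (cases n) auto
    \<comment> \<open>\<open>P (Suc j)\<close> is left out. As it equals \<open>P j\<close>, the
      step across the gap is still strict by \<open>jump\<close>.\<close>
    define P' where "P' i = (if i \<le> j then P i else P (Suc i))" for i
    have "prime_of ?V (P' i)" if "i \<le> m" for i using P that j m by (auto simp: P'_def)
    moreover have "P' i \<subset> P' (Suc i)" if "i < m" for i
    proof -
      consider "i < j" | "i = j" | "j < i" by linarith
      then show ?thesis
      proof cases
        case 1
        then show ?thesis using jump[of i j] that j m by (simp add: P'_def)
      next
        case 2
        then show ?thesis using jump[of "Suc i" j] that j m by (simp add: P'_def)
      next
        case 3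
        then show ?thesis using jump[of "Suc i" j] that j m by (simp add: P'_def)
      qed
    qed
    ultimately have "prime_chain (subset_ring ?V) m P'"
      by (simp add: prime_chain_subset_ring_iff[OF V])
    then have "enat m \<le> krull_dim (subset_ring ?V)" by (rule krull_dim_geI)
    then show ?thesis by (simp add: m flip: eSuc_enat)
  qed
qed

section \<open>Integer-valued rational functions\<close>

lemma rat_eval_ops:
  assumes "rat_defined_at x a" "rat_defined_at y a"
  shows "rat_eval (x + y) a = rat_eval x a + rat_eval y a"
    "rat_eval (x * y) a = rat_eval x a * rat_eval y a"
proof -
  obtain p q where p: "x = Fract p q" "poly q a \<noteq> 0" using assms(1) unfolding rat_defined_at_def by blast
  obtain r s where r: "y = Fract r s" "poly s a \<noteq> 0" using assms(2) unfolding rat_defined_at_def by blast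
  have nz: "q \<noteq> 0" "s \<noteq> 0" "poly (q * s) a \<noteq> 0" using p r by auto
  have "x + y = Fract (p * s + r * q) (q * s)" "x * y = Fract (p * r) (q * s)" using p r nz by simp_all
  then show "rat_eval (x + y) a = rat_eval x a + rat_eval y a"
    "rat_eval (x * y) a = rat_eval x a * rat_eval y a"
    using rat_eval_Fract[OF nz(3)] rat_eval_Fract[OF p(2)] rat_eval_Fract[OF r(2)] p r
    by (simp_all add: add_frac_eq)
qed

lemma rat_eval_to_fract [simp]: "rat_defined_at (to_fract p) a" "rat_eval (to_fract p) a = poly p a"
  using rat_eval_Fract[of 1 a p] unfolding rat_defined_at_def to_fract_def
  by (intro exI[of _ p] exI[of _ 1], simp_all)

lemma rat_eval_const_fract [simp]: "rat_defined_at (const_fract c) a" "rat_eval (const_fract c) a = c"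
  by (simp_all add: const_fract_def)

lemma to_fract_in_IntR_iff: "to_fract p \<in> IntR E D \<longleftrightarrow> (\<forall>a\<in>E. poly p a \<in> D)"
  by (simp add: IntR_def)

lemma const_fract_in_IntR: "c \<in> D \<Longrightarrow> const_fract c \<in> IntR E D"
  by (simp add: IntR_def)

text \<open>All constants are quotients of constants from \<open>D\<close>, and \<open>X\<close> is
  recovered as \<open>inverse d\<close> times the integer-valued \<open>dX\<close>. Polynomials
  follow, and then their quotients.\<close>

lemma quot_field_IntR:
  fixes D E :: "'k::field set"
  assumes D: "is_subdomain D" and quot: "quot_field D = UNIV" and E: "fractional_subset D E"
  shows "quot_field (IntR E D) = UNIV"
proof -
  note R = is_subdomainD[OF is_subdomain_IntR[OF D, of E]]
    is_subdomain_closed[OF is_subdomain_IntR[OF D, of E]]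
  let ?Q = "quot_field (IntR E D)"
  have plus: "x + y \<in> ?Q" and mult: "x * y \<in> ?Q" if xy: "x \<in> ?Q" "y \<in> ?Q" for x y
  proof -
    obtain a b c d where *: "x = a / b" "y = c / d" "a \<in> IntR E D" "b \<in> IntR E D" "b \<noteq> 0"
      "c \<in> IntR E D" "d \<in> IntR E D" "d \<noteq> 0" using xy unfolding quot_field_def by blast
    have bd: "b * d \<noteq> 0" "b * d \<in> IntR E D" using * R(3) by auto
    have "x + y = (a * d + c * b) / (b * d)" "x * y = (a * c) / (b * d)"
      using * by (simp_all add: add_frac_eq)
    moreover have "a * d + c * b \<in> IntR E D" "a * c \<in> IntR E D" by (intro R(3,6) *)+
    ultimately show "x + y \<in> ?Q" "x * y \<in> ?Q" using bd unfolding quot_field_def by blast+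
  qed
  have sub: "IntR E D \<subseteq> ?Q"
  proof
    fix x assume "x \<in> IntR E D"
    moreover have "x = x / 1" by simp
    ultimately show "x \<in> ?Q" using R(1) unfolding quot_field_def by (metis (mono_tags, lifting) mem_Collect_eq zero_neq_one)
  qed
  have const: "const_fract c \<in> ?Q" for c
  proof -
    have "c \<in> quot_field D" using quot by simp
    then obtain a b where ab: "c = a / b" "a \<in> D" "b \<in> D" "b \<noteq> 0" unfolding quot_field_def by blast
    have "const_fract c = const_fract a / const_fract b" "const_fract b \<noteq> 0" using ab by simp_all
    then show ?thesis
      using const_fract_in_IntR[OF ab(2)] const_fract_in_IntR[OF ab(3)] unfolding quot_field_def by blast
  qed
  obtain d where d: "d \<in> D" "d \<noteq> 0" "\<forall>x\<in>E. d * x \<in> D" using E unfolding fractional_subset_def by blast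
  have "to_fract [:0, d:] \<in> IntR E D" using d by (simp add: to_fract_in_IntR_iff mult.commute)
  then have "const_fract (inverse d) * to_fract [:0, d:] \<in> ?Q" using mult const sub by blast
  moreover have "const_fract (inverse d) * to_fract [:0, d:] = to_fract [:0, 1:]"
    using d(2) by (simp flip: to_fract_smult del: const_fract_inverse)
  ultimately have X: "to_fract [:0, 1:] \<in> ?Q" by simp
  have pol: "to_fract p \<in> ?Q" for p
  proof (induction p)
    case 0
    show ?case using R(4) sub by auto
  next
    case (pCons c p)
    have "pCons c p = [:c:] + [:0, 1:] * p" by simp
    then have "to_fract (pCons c p) = const_fract c + to_fract [:0, 1:] * to_fract p"
      by (simp only: to_fract_add to_fract_mult const_fract_def)
    then show ?case using plus[OF const mult[OF X pCons.IH]] by simp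
  qed
  have inv: "inverse x \<in> ?Q" if x: "x \<in> ?Q" for x
  proof (cases "x = 0")
    case True
    then show ?thesis using x by simp
  next
    case False
    obtain a b where *: "x = a / b" "a \<in> IntR E D" "b \<in> IntR E D" "b \<noteq> 0"
      using x unfolding quot_field_def by blast
    have "inverse x = b / a" "a \<noteq> 0" using * False by auto
    then show ?thesis using * unfolding quot_field_def by blast
  qed
  have "x \<in> ?Q" for x
  proof -
    obtain p q where "x = Fract p q" "q \<noteq> 0" by (cases x) auto
    then have "x = to_fract p * inverse (to_fract q)" by (simp add: Fract_conv_to_fract divide_inverse)
    then show ?thesis using mult[OF pol inv[OF pol]] by simp
  qed
  then show ?thesis by blast
qed

text \<open>Evaluation at a point of \<open>E\<close> maps \<open>Int\<^sup>R(E, D)\<close> onto \<open>D\<close> with nonzero kernel, so pulling back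
  a chain of primes of \<open>D\<close> and adding the zero ideal lengthens it by one.\<close>

lemma eSuc_krull_dim_le_IntR:
  fixes D E :: "'k::field set"
  assumes D: "is_subdomain D" and ne: "E \<noteq> {}" and E: "fractional_subset D E"
  shows "eSuc (krull_dim (subset_ring D)) \<le> krull_dim (subset_ring (IntR E D))"
proof (rule eSuc_krull_dim_leI[OF D])
  fix n P assume "prime_chain (subset_ring D) n P"
  then have P: "\<forall>i\<le>n. prime_of D (P i)" "\<forall>i<n. P i \<subset> P (Suc i)"
    by (simp_all add: prime_chain_subset_ring_iff[OF D])
  note R = is_subdomain_IntR[OF D, of E]
  obtain a where a: "a \<in> E" using ne by blast
  obtain d where d: "d \<in> D" "d \<noteq> 0" "\<forall>x\<in>E. d * x \<in> D" using E unfolding fractional_subset_def by blast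
  have def: "rat_defined_at x a" "rat_eval x a \<in> D" if "x \<in> IntR E D" for x
    using that a unfolding IntR_def by blast+
  define pull where "pull I = {x \<in> IntR E D. rat_eval x a \<in> I}" for I
  define Q where "Q i = (case i of 0 \<Rightarrow> {0} | Suc j \<Rightarrow> pull (P j))" for i
  have ev0: "rat_eval 0 a = 0" "rat_eval 1 a = 1"
    using rat_eval_const_fract(2)[of 0 a] rat_eval_const_fract(2)[of 1 a] by simp_all
  have pull: "prime_of (IntR E D) (pull I)" if I: "prime_of D I" for I
    unfolding prime_of_def
  proof (intro conjI ballI impI)
    note I' = prime_ofD[OF I] and R' = is_subdomainD[OF R] is_subdomain_closed[OF R]
    show "pull I \<subseteq> IntR E D" "0 \<in> pull I" "1 \<notin> pull I" using I'(2,3) R'(4) by (auto simp: pull_def ev0)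
    show "x + y \<in> pull I" if "x \<in> pull I" "y \<in> pull I" for x y
      using that I'(4) R'(6) by (simp add: pull_def rat_eval_ops def)
    show "x * y \<in> pull I" if "x \<in> IntR E D" "y \<in> pull I" for x y
      using that I'(5) R'(3) by (simp add: pull_def rat_eval_ops def)
    show "x \<in> pull I \<or> y \<in> pull I" if "x \<in> IntR E D" "y \<in> IntR E D" "x * y \<in> pull I" for x y
      using that I'(6) by (simp add: pull_def rat_eval_ops def)
  qed
  have "prime_of (IntR E D) (Q i)" if "i \<le> Suc n" for i
    using that P(1) pull prime_of_zero[OF R] by (cases i) (auto simp: Q_def)
  moreover have "Q i \<subset> Q (Suc i)" if "i < Suc n" for i
  proof (cases i)
    case 0
    \<comment> \<open>This is \<open>d(X - a)\<close>; the factor \<open>d\<close> keeps the values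
      \<open>d * b - d * a\<close> on \<open>E\<close> inside \<open>D\<close>.\<close>
    have 1: "to_fract [:- (d * a), d:] \<in> IntR E D"
    proof -
      have "poly [:- (d * a), d:] b = d * b - d * a" for b by (simp add: mult.commute)
      then show ?thesis using d(3) a is_subdomainD(2)[OF D] unfolding to_fract_in_IntR_iff by metis
    qed
    moreover have "prime_of D (P 0)" using P by simp
    note P0 = this
    have "rat_eval (to_fract [:- (d * a), d:]) a = 0" by (simp add: mult.commute)
    ultimately have "to_fract [:- (d * a), d:] \<in> Q (Suc 0)"
      using prime_ofD(2)[OF P0] by (simp add: Q_def pull_def)
    moreover have "to_fract [:- (d * a), d:] \<noteq> 0" using d(2) by simp
    moreover have "0 \<in> Q (Suc 0)" using prime_ofD(2)[OF pull[OF P0]] by (simp add: Q_def)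
    ultimately have "{0} \<subset> Q (Suc 0)" by (metis psubsetI empty_subsetI insert_subset singletonD)
    then show ?thesis using 0 by (simp add: Q_def)
  next
    case (Suc j)
    then have j: "P j \<subset> P (Suc j)" "prime_of D (P (Suc j))" using that P by auto
    then obtain c where c: "c \<in> P (Suc j)" "c \<notin> P j" by blast
    then have "c \<in> D" using prime_ofD(1)[OF j(2)] by blast
    \<comment> \<open>Evaluation fixes constants, so an element separating two primes of
      \<open>D\<close> also separates their preimages.\<close>
    then have "const_fract c \<in> pull (P (Suc j))" "const_fract c \<notin> pull (P j)"
      using c by (simp_all add: pull_def const_fract_in_IntR)
    moreover have "pull (P j) \<subseteq> pull (P (Suc j))" using j(1) unfolding pull_def by blast
    ultimately show ?thesis using Suc by (auto simp: Q_def)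
  qed
  ultimately have "prime_chain (subset_ring (IntR E D)) (Suc n) Q"
    by (simp add: prime_chain_subset_ring_iff[OF R])
  then show "eSuc (enat n) \<le> krull_dim (subset_ring (IntR E D))"
    by (metis krull_dim_geI eSuc_enat)
qed

text \<open>The functions defined at \<open>a\<close> form a discrete valuation ring, so it suffices
  to compare the orders of numerator and denominator at \<open>a\<close>. The zero value is recorded
  because 0 lies in every ring of admissible values.\<close>

lemma rat_defined_at_or_inverse:
  fixes x :: "'k::field poly fract"
  assumes "x \<noteq> 0"
  shows "rat_defined_at x a \<or> rat_defined_at (inverse x) a \<and> rat_eval (inverse x) a = 0"
proof -
  have split: "\<exists>m p'. p = [:- a, 1:] ^ m * p' \<and> poly p' a \<noteq> 0" if "p \<noteq> 0" for p
    using order_decomp[OF that, of a] by (metis poly_eq_0_iff_dvd)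
  obtain p q where x: "x = Fract p q" "q \<noteq> 0" by (cases x) auto
  have "p \<noteq> 0" using assms x by (auto simp: Fract_conv_to_fract)
  then obtain m p' where p: "p = [:- a, 1:] ^ m * p'" "poly p' a \<noteq> 0" using split by blast
  obtain n q' where q: "q = [:- a, 1:] ^ n * q'" "poly q' a \<noteq> 0" using split x(2) by blast
  let ?t = "to_fract [:- a, 1:]"
  have t0: "?t \<noteq> 0" by simp
  have p'q': "to_fract p' \<noteq> 0" "to_fract q' \<noteq> 0" using p(2) q(2) by auto
  have x_eq: "x = ?t ^ m * to_fract p' / (?t ^ n * to_fract q')"
    by (simp add: x(1) p(1) q(1) Fract_conv_to_fract to_fract_power)
  show ?thesis
  proof (cases "n \<le> m")
    case True
    then have "?t ^ m = ?t ^ (m - n) * ?t ^ n" by (simp flip: power_add)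
    then have "x = Fract ([:- a, 1:] ^ (m - n) * p') q'"
      unfolding x_eq using t0 by (simp add: Fract_conv_to_fract to_fract_power)
    then show ?thesis using q(2) unfolding rat_defined_at_def by blast
  next
    case False
    then have "?t ^ n = ?t ^ (n - m) * ?t ^ m" by (simp flip: power_add)
    then have "inverse x = Fract ([:- a, 1:] ^ (n - m) * q') p'"
      unfolding x_eq using t0 by (simp add: Fract_conv_to_fract to_fract_power)
    moreover have "poly ([:- a, 1:] ^ (n - m) * q') a = 0" using False by simp
    ultimately show ?thesis
      using p(2) rat_eval_Fract[OF p(2), of "[:- a, 1:] ^ (n - m) * q'"]
      unfolding rat_defined_at_def by auto
  qed
qed

text \<open>A composite valuation: \<open>IntR {a} V\<close> is the preimage of \<open>V\<close>
  under the residue map at \<open>a\<close>. If only one of \<open>x\<close> and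
  \<open>inverse x\<close> is defined at \<open>a\<close>, it vanishes there; if both are, their
  values are inverse to each other and \<open>V\<close> decides.\<close>

lemma IntR_singleton_valuation:
  fixes V :: "'k::field set"
  assumes V: "is_subdomain V" and val: "\<And>x. x \<noteq> 0 \<Longrightarrow> x \<in> V \<or> inverse x \<in> V"
    and x: "x \<noteq> 0"
  shows "x \<in> IntR {a} V \<or> inverse x \<in> IntR {a} V"
proof -
  have z: "0 \<in> V" by (rule is_subdomain_closed(1)[OF V])
  consider "rat_eval (inverse x) a = 0" "rat_defined_at (inverse x) a"
    | "rat_eval x a = 0" "rat_defined_at x a"
    | "rat_defined_at x a" "rat_defined_at (inverse x) a"
    using rat_defined_at_or_inverse[OF x, of a] rat_defined_at_or_inverse[of "inverse x" a] x by auto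
  then show ?thesis
  proof cases
    case 3
    have "rat_eval x a * rat_eval (inverse x) a = 1"
      using rat_eval_ops(2)[OF 3] x rat_eval_const_fract(2)[of 1 a] by simp
    then have "rat_eval x a \<noteq> 0" "rat_eval (inverse x) a = inverse (rat_eval x a)"
      by (auto dest: inverse_unique)
    then show ?thesis using val[of "rat_eval x a"] 3 by (auto simp: IntR_def)
  qed (use z in \<open>auto simp: IntR_def\<close>)
qed

lemma valuative_dim_IntR:
  fixes D E :: "'k::field set"
  assumes D: "is_subdomain D" and quot: "quot_field D = UNIV"
    and ne: "E \<noteq> {}" and E: "fractional_subset D E"
  shows "valuative_dim (IntR E D) = eSuc (valuative_dim D)"
proof (rule antisym)
  note quotR = quot_field_IntR[OF D quot E]
  show "valuative_dim (IntR E D) \<le> eSuc (valuative_dim D)"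
    unfolding valuative_dim_def[of "IntR E D"]
  proof (rule Sup_least, clarify)
    fix W assume "valuation_overring (IntR E D) W"
    note W = valuation_overringD[OF this quotR]
    let ?V = "const_part W"
    have "valuation_overring D ?V"
    proof (rule valuation_overringI[OF quot])
      show "D \<subseteq> ?V" using W(2) const_fract_in_IntR[of _ D E] unfolding const_part_def by blast
      show "c \<in> ?V \<or> inverse c \<in> ?V" if "c \<noteq> 0" for c
        using W(3)[of "const_fract c"] that by (simp add: const_part_def)
    qed (rule is_subdomain_const_part[OF W(1)])
    then have "krull_dim (subset_ring ?V) \<le> valuative_dim D"
      unfolding valuative_dim_def by (intro Sup_upper) blast
    then show "krull_dim (subset_ring W) \<le> eSuc (valuative_dim D)"
      using krull_dim_le_const_part[OF W(1,3)] by (meson eSuc_ile_mono order_trans)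
  qed
  obtain a where a: "a \<in> E" using ne by blast
  \<comment> \<open>The whole field makes the supremum one over a nonempty set, so that
    \<open>eSuc\<close> can be moved inside.\<close>
  have "valuation_overring D UNIV" by (rule valuation_overringI[OF quot]) (auto intro: is_subdomainI)
  then have ne': "{krull_dim (subset_ring V) |V. valuation_overring D V} \<noteq> {}" by blast
  show "eSuc (valuative_dim D) \<le> valuative_dim (IntR E D)"
    unfolding valuative_dim_def[of D] eSuc_Sup[OF ne']
  proof (rule Sup_least, clarify)
    fix V assume "valuation_overring D V"
    note V = valuation_overringD[OF this quot]
    let ?W = "IntR {a} V"
    \<comment> \<open>The \<open>d\<close> belonging to \<open>E\<close> serves here too, since
      \<open>D \<subseteq> V\<close>. Thus \<open>eSuc_krull_dim_le_IntR\<close> applies to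
      \<open>V\<close> and \<open>{a}\<close>.\<close>
    have frac: "fractional_subset V {a}"
      using E a V(2) quot quot_field_mono[OF V(2)] unfolding fractional_subset_def by blast
    have "valuation_overring (IntR E D) ?W"
    proof (rule valuation_overringI[OF quotR])
      show "IntR E D \<subseteq> ?W" using a V(2) unfolding IntR_def by blast
      show "x \<in> ?W \<or> inverse x \<in> ?W" if "x \<noteq> 0" for x
        by (rule IntR_singleton_valuation[OF V(1,3) that])
    qed (rule is_subdomain_IntR[OF V(1)])
    then have "krull_dim (subset_ring ?W) \<le> valuative_dim (IntR E D)"
      unfolding valuative_dim_def by (intro Sup_upper) blast
    then show "eSuc (krull_dim (subset_ring V)) \<le> valuative_dim (IntR E D)"
      using eSuc_krull_dim_le_IntR[OF V(1) _ frac] by (meson insert_not_empty order_trans)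
  qed
qed

theorem theorem1p13:
  fixes D E :: "'k::field set"
  assumes "is_subdomain D"
    and "quot_field D = UNIV"
    and "E \<noteq> {}"
    and "fractional_subset D E"
  shows "jaffard D \<longleftrightarrow>
    jaffard (IntR E D) \<and>
    krull_dim (subset_ring (IntR E D)) = 1 + krull_dim (subset_ring D)"
proof -
  have R: "is_subdomain (IntR E D)" using assms(1) by (rule is_subdomain_IntR)
  have v: "valuative_dim (IntR E D) = eSuc (valuative_dim D)"
    by (rule valuative_dim_IntR[OF assms])
  have lower: "eSuc (krull_dim (subset_ring D)) \<le> krull_dim (subset_ring (IntR E D))"
    by (rule eSuc_krull_dim_le_IntR[OF assms(1,3,4)])
  have upper: "krull_dim (subset_ring (IntR E D)) \<le> valuative_dim (IntR E D)"
    by (rule krull_dim_le_valuative_dim[OF R quot_field_IntR[OF assms(1,2,4)]])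
  have fin: "eSuc n < \<infinity> \<longleftrightarrow> n < \<infinity>" for n by (cases n) (simp_all add: eSuc_enat)
  \<comment> \<open>If \<open>D\<close> is Jaffard, the ends \<open>1 + dim D\<close> and
    \<open>1 + dim\<^sub>v D\<close> of the chain of inequalities agree, and so does everything
    between. Conversely the right-hand side gives \<open>1 + dim D = 1 + dim\<^sub>v D\<close>, and
    \<open>eSuc\<close> is injective; \<open>fin\<close> transfers finiteness both ways.\<close>
  show ?thesis
    unfolding jaffard_def plus_1_eSuc
    using assms(1) R v fin lower upper by auto
qed

end
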